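(* Every cyclically $4$-edge-connected cubic graph $G$ with colouring defect $\operatorname{df}(G)=4$ admits a Berge cover, that is, there exist at most five perfect matchings of $G$ whose union contains every edge of $G$.
   Context: Graphs may have multiple edges and loops. A connected graph is cyclically $k$-edge-connected if the removal of fewer than $k$ edges cannot leave a subgraph with at least two components containing circuits. The colouring defect $\operatorname{df}(G)$ of a bridgeless cubic graph $G$ is the minimum, over all collections $\{M_1,M_2,M_3\}$ of three (not necessarily distinct) perfect matchings of $G$, of the number of edges belonging to none of $M_1,M_2,M_3$. *)

theory Defs
  imports Main
begin

text \<open>A finite multigraph (loops and parallel edges allowed) is given by a vertex set V,
an edge set E and an incidence map ends: each edge has one end (a loop) or two ends.\<close>

definition multigraph :: "'v set \<Rightarrow> 'e set \<Rightarrow> ('e \<Rightarrow> 'v set) \<Rightarrow> bool" where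
  "multigraph V E ends \<longleftrightarrow> finite V \<and> finite E \<and>
     (\<forall>e\<in>E. ends e \<subseteq> V \<and> (card (ends e) = 1 \<or> card (ends e) = 2))"

definition degree :: "'e set \<Rightarrow> ('e \<Rightarrow> 'v set) \<Rightarrow> 'v \<Rightarrow> nat" where
  "degree F ends v = (\<Sum>e\<in>{e\<in>F. v \<in> ends e}. if ends e = {v} then 2 else 1)"

definition cubic :: "'v set \<Rightarrow> 'e set \<Rightarrow> ('e \<Rightarrow> 'v set) \<Rightarrow> bool" where
  "cubic V E ends \<longleftrightarrow> multigraph V E ends \<and> (\<forall>v\<in>V. degree E ends v = 3)"

definition perfect_matching :: "'v set \<Rightarrow> 'e set \<Rightarrow> ('e \<Rightarrow> 'v set) \<Rightarrow> 'e set \<Rightarrow> bool" where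
  "perfect_matching V E ends M \<longleftrightarrow> M \<subseteq> E \<and> (\<forall>e\<in>M. card (ends e) = 2) \<and>
     (\<forall>v\<in>V. \<exists>!e. e \<in> M \<and> v \<in> ends e)"

definition reach :: "'e set \<Rightarrow> ('e \<Rightarrow> 'v set) \<Rightarrow> 'v \<Rightarrow> 'v \<Rightarrow> bool" where
  "reach F ends = (\<lambda>x y. \<exists>e\<in>F. ends e = {x, y})\<^sup>*\<^sup>*"

definition connected_graph :: "'v set \<Rightarrow> 'e set \<Rightarrow> ('e \<Rightarrow> 'v set) \<Rightarrow> bool" where
  "connected_graph V F ends \<longleftrightarrow> V \<noteq> {} \<and> (\<forall>u\<in>V. \<forall>v\<in>V. reach F ends u v)"

text \<open>A circuit: a nonempty finite edge set forming a connected 2-regular subgraph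
(this includes loops and digons formed by parallel edges).\<close>
definition circuit :: "('e \<Rightarrow> 'v set) \<Rightarrow> 'e set \<Rightarrow> bool" where
  "circuit ends C \<longleftrightarrow> C \<noteq> {} \<and> finite C \<and>
     connected_graph (\<Union>(ends ` C)) C ends \<and>
     (\<forall>v\<in>\<Union>(ends ` C). degree C ends v = 2)"

definition cyclically_edge_connected :: "nat \<Rightarrow> 'v set \<Rightarrow> 'e set \<Rightarrow> ('e \<Rightarrow> 'v set) \<Rightarrow> bool" where
  "cyclically_edge_connected k V E ends \<longleftrightarrow> connected_graph V E ends \<and>
     (\<forall>S\<subseteq>E. card S < k \<longrightarrow>
        \<not> (\<exists>C1 C2. C1 \<subseteq> E - S \<and> C2 \<subseteq> E - S \<and> circuit ends C1 \<and> circuit ends C2 \<and>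
               (\<forall>u\<in>\<Union>(ends ` C1). \<forall>w\<in>\<Union>(ends ` C2). \<not> reach (E - S) ends u w)))"

text \<open>Colouring defect: minimum number of edges missed by three perfect matchings
(convention 0 if no perfect matching exists; irrelevant for bridgeless cubic graphs).\<close>
definition colouring_defect :: "'v set \<Rightarrow> 'e set \<Rightarrow> ('e \<Rightarrow> 'v set) \<Rightarrow> nat" where
  "colouring_defect V E ends =
     (let D = {card (E - (M1 \<union> M2 \<union> M3)) | M1 M2 M3.
                perfect_matching V E ends M1 \<and> perfect_matching V E ends M2 \<and>
                perfect_matching V E ends M3}
      in if D = {} then 0 else Min D)"

end

theory Submission
  imports Defs
begin

text \<open>Let \<open>w d\<close> be the number of the three given matchings that contain \<open>d\<close>, minus one; the
  weights at every vertex sum to \<open>0\<close>, and four edges have weight \<open>-1\<close>. We split these into two pairs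
  and put each pair into a perfect matching. If a disjoint uncovered pair \<open>p, q\<close> lies in no
  perfect matching, Tutte's theorem for \<open>V - ends p - ends q\<close> yields a barrier \<open>S\<close> containing both
  edges. Cyclic 4-edge-connectivity makes every odd component with a boundary of size 3 a single
  vertex, so counting edges leaves two cases: either \<open>S\<close> spans just one further edge, and
  summing weights shows that it lies in all three matchings; or \<open>S\<close> spans nothing else and there is
  one component with a boundary of size 5, whose weight is 4, so that it contains all edges of
  positive weight and no uncovered edge. Both are impossible for both pairs when the pairs are
  chosen along edges of positive weight.\<close>

section \<open>Hall's and Tutte's theorems\<close>

text \<open>Induction on \<open>A\<close>. If a nonempty proper subset \<open>B\<close> is tight,
  \<open>B\<close> is matched into its neighbourhood and \<open>A - B\<close> into the remaining
  elements; otherwise every nonempty proper subset has a spare neighbour, so one element can be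
  assigned arbitrarily.\<close>

lemma hall_marriage:
  assumes "finite A" "\<And>a. a \<in> A \<Longrightarrow> finite (N a)"
    and "\<And>B. B \<subseteq> A \<Longrightarrow> card B \<le> card (\<Union>(N ` B))"
  shows "\<exists>f. inj_on f A \<and> (\<forall>a\<in>A. f a \<in> N a)"
  using assms
proof (induction A arbitrary: N rule: finite_psubset_induct)
  case (psubset A)
  note fin = psubset.prems(1) and hall = psubset.prems(2)
  show ?case
  proof (cases "\<exists>B. B \<subset> A \<and> B \<noteq> {} \<and> card B = card (\<Union>(N ` B))")
    case True
    then obtain B where B: "B \<subset> A" "B \<noteq> {}" "card B = card (\<Union>(N ` B))" by blast
    define N' where "N' a = N a - \<Union>(N ` B)" for a
    have "finite B" using B psubset.hyps finite_subset by blast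
    then have finB: "finite B" "finite (\<Union>(N ` B))" using B fin by auto
    have "\<exists>f. inj_on f B \<and> (\<forall>a\<in>B. f a \<in> N a)"
      using B by (intro psubset.IH fin hall) auto
    then obtain f where f: "inj_on f B" "\<And>a. a \<in> B \<Longrightarrow> f a \<in> N a" by blast
    have "\<exists>g. inj_on g (A - B) \<and> (\<forall>a\<in>A - B. g a \<in> N' a)"
    proof (intro psubset.IH)
      fix C assume C: "C \<subseteq> A - B"
      have finC: "finite C" using C psubset.hyps finite_subset by blast
      have finNC: "finite (\<Union>(N' ` C))"
        using C finC fin by (auto simp: N'_def)
      \<comment> \<open>Hall's condition for \<open>C \<union> B\<close>, minus the tight equality
        for \<open>B\<close>, is Hall's condition for \<open>C\<close> with respect to
        \<open>N'\<close>.\<close>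
      have "card C + card B = card (C \<union> B)"
        using C finC finB by (subst card_Un_disjoint) auto
      also have "\<dots> \<le> card (\<Union>(N ` (C \<union> B)))"
        using C B by (intro hall) auto
      also have "\<Union>(N ` (C \<union> B)) = \<Union>(N' ` C) \<union> \<Union>(N ` B)"
        by (auto simp: N'_def)
      also have "card \<dots> = card (\<Union>(N' ` C)) + card (\<Union>(N ` B))"
        using finNC finB by (intro card_Un_disjoint) (auto simp: N'_def)
      finally show "card C \<le> card (\<Union>(N' ` C))" using B by simp
    qed (use B fin in \<open>auto simp: N'_def\<close>)
    then obtain g where g: "inj_on g (A - B)" "\<And>a. a \<in> A - B \<Longrightarrow> g a \<in> N' a" by blast
    let ?h = "\<lambda>a. if a \<in> B then f a else g a"
    have "inj_on ?h A"
    proof (rule inj_onI)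
      fix a b assume ab: "a \<in> A" "b \<in> A" "?h a = ?h b"
      have "a \<in> B \<longleftrightarrow> b \<in> B"
        using ab f(2) g(2) by (cases "a \<in> B"; cases "b \<in> B") (fastforce simp: N'_def)+
      then show "a = b"
        using ab f(1) g(1) by (auto simp: inj_on_def split: if_splits)
    qed
    moreover have "\<forall>a\<in>A. ?h a \<in> N a" using f(2) g(2) by (auto simp: N'_def)
    ultimately show ?thesis by blast
  next
    case False
    show ?thesis
    proof (cases "A = {}")
      case False
      then obtain a where a: "a \<in> A" by blast
      have "N a \<noteq> {}" using hall[of "{a}"] a by auto
      then obtain x where x: "x \<in> N a" by blast
      define N' where "N' b = N b - {x}" for b
      have "\<exists>g. inj_on g (A - {a}) \<and> (\<forall>b\<in>A - {a}. g b \<in> N' b)"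
      proof (intro psubset.IH)
        fix C assume C: "C \<subseteq> A - {a}"
        show "card C \<le> card (\<Union>(N' ` C))"
        proof (cases "C = {}")
          case nonempty: False
          have "card C < card (\<Union>(N ` C))"
            using \<open>\<not> (\<exists>B. _ B)\<close> hall[of C] C a nonempty
            by (metis Diff_subset le_neq_implies_less order.trans psubsetI insert_Diff insert_iff subset_iff Diff_iff)
          moreover have "\<Union>(N' ` C) = \<Union>(N ` C) - {x}" by (auto simp: N'_def)
          ultimately show ?thesis using diff_card_le_card_Diff[of "{x}" "\<Union>(N ` C)"] by simp
        qed simp
      qed (use a fin in \<open>auto simp: N'_def\<close>)
      then obtain g where g: "inj_on g (A - {a})" "\<And>b. b \<in> A - {a} \<Longrightarrow> g b \<in> N' b" by blast
      have "inj_on (g(a := x)) A"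
        using g by (auto simp: inj_on_def N'_def)
      moreover have "\<forall>b\<in>A. (g(a := x)) b \<in> N b" using g(2) x by (auto simp: N'_def)
      ultimately show ?thesis by blast
    qed simp
  qed
qed

lemma two_ends:
  assumes "card A = 1 \<or> card A = 2" "x \<in> A" "y \<in> A" "x \<noteq> y"
  shows "A = {x, y}"
proof -
  have "finite A" using assms(1) by (auto intro: card_ge_0_finite)
  then show ?thesis using assms by (intro card_seteq[symmetric]) auto
qed

section \<open>Perfect matchings of induced subgraphs\<close>

definition inner :: "'e set \<Rightarrow> ('e \<Rightarrow> 'v set) \<Rightarrow> 'v set \<Rightarrow> 'e set" where
  "inner E ends X = {d \<in> E. ends d \<subseteq> X}"

lemma perfect_matching_UN:
  assumes pm: "\<And>i. i \<in> I \<Longrightarrow> perfect_matching (X i) (inner E ends (X i)) ends (M i)"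
    and disj: "\<And>i j. i \<in> I \<Longrightarrow> j \<in> I \<Longrightarrow> i \<noteq> j \<Longrightarrow> X i \<inter> X j = {}"
  shows "perfect_matching (\<Union>i\<in>I. X i) (inner E ends (\<Union>i\<in>I. X i)) ends (\<Union>i\<in>I. M i)"
proof -
  have sub: "d \<in> E" "ends d \<subseteq> X i" "card (ends d) = 2" if "i \<in> I" "d \<in> M i" for i d
  proof -
    from pm[OF that(1)] have "M i \<subseteq> inner E ends (X i)" "\<forall>d\<in>M i. card (ends d) = 2"
      unfolding perfect_matching_def by simp_all
    then show "d \<in> E" "ends d \<subseteq> X i" "card (ends d) = 2" using that(2) by (auto simp: inner_def)
  qed
  show ?thesis
    unfolding perfect_matching_def
  proof (intro conjI ballI)
    show "(\<Union>i\<in>I. M i) \<subseteq> inner E ends (\<Union>i\<in>I. X i)"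
      using sub(1,2) by (fastforce simp: inner_def)
    show "card (ends d) = 2" if "d \<in> (\<Union>i\<in>I. M i)" for d
      using that sub(3) by blast
    fix v assume "v \<in> (\<Union>i\<in>I. X i)"
    then obtain i where i: "i \<in> I" "v \<in> X i" by blast
    then have "\<exists>!d. d \<in> M i \<and> v \<in> ends d" using pm[OF i(1)] by (simp add: perfect_matching_def)
    then obtain d where d: "d \<in> M i" "v \<in> ends d" and uniq: "\<And>d'. d' \<in> M i \<Longrightarrow> v \<in> ends d' \<Longrightarrow> d' = d"
      by auto
    show "\<exists>!d. d \<in> (\<Union>i\<in>I. M i) \<and> v \<in> ends d"
    proof (intro ex1I[of _ d])
      fix d' assume "d' \<in> (\<Union>i\<in>I. M i) \<and> v \<in> ends d'"
      then obtain j where j: "j \<in> I" "d' \<in> M j" "v \<in> ends d'" by blast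
      then have "v \<in> X j" using sub(2) by blast
      then have "i = j" using disj i j by blast
      then show "d' = d" using uniq j by blast
    qed (use i d in blast)
  qed
qed

lemma perfect_matching_Un:
  assumes "perfect_matching X (inner E ends X) ends M" "perfect_matching Y (inner E ends Y) ends N"
    and "X \<inter> Y = {}"
  shows "perfect_matching (X \<union> Y) (inner E ends (X \<union> Y)) ends (M \<union> N)"
proof -
  have "perfect_matching (\<Union>b\<in>UNIV. if b then X else Y) (inner E ends (\<Union>b\<in>UNIV. if b then X else Y))
      ends (\<Union>b\<in>UNIV. if b then M else N)"
  proof (rule perfect_matching_UN)
    show "perfect_matching (if b then X else Y) (inner E ends (if b then X else Y)) ends (if b then M else N)" for b
      using assms by simp
    show "(if a then X else Y) \<inter> (if b then X else Y) = {}" if "a \<noteq> b" for a b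
      using assms(3) that by (cases a) (simp_all add: Int_commute)
  qed
  then show ?thesis by (simp add: UNIV_bool Un_commute)
qed

lemma perfect_matching_edge:
  assumes "d \<in> E" "card (ends d) = 2"
  shows "perfect_matching (ends d) (inner E ends (ends d)) ends {d}"
  using assms by (auto simp: perfect_matching_def inner_def)

text \<open>The members of an odd family need not be connected: each is an odd union of components
  of the graph induced on \<open>X - T\<close>. This is all that Tutte's condition uses, and it spares us
  any talk about components.\<close>

definition odd_family :: "'e set \<Rightarrow> ('e \<Rightarrow> 'v set) \<Rightarrow> 'v set \<Rightarrow> 'v set \<Rightarrow> 'v set set \<Rightarrow> bool" where
  "odd_family E ends X T \<K> \<longleftrightarrow> T \<subseteq> X \<and> pairwise disjnt \<K> \<and>
     (\<forall>K\<in>\<K>. K \<subseteq> X - T \<and> odd (card K) \<and>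
        (\<forall>d\<in>inner E ends X. ends d \<inter> K \<noteq> {} \<longrightarrow> ends d \<subseteq> K \<union> T))"

section \<open>Parity and left-over vertices of odd families\<close>

lemma odd_family_finite:
  assumes "odd_family E ends X T \<K>" "finite X"
  shows "finite \<K>" "finite T" "finite (\<Union>\<K>)" "\<And>K. K \<in> \<K> \<Longrightarrow> finite K"
proof -
  have "\<K> \<subseteq> Pow X" "T \<subseteq> X" using assms(1) by (auto simp: odd_family_def)
  moreover have "\<Union>\<K> \<subseteq> X" using calculation by blast
  ultimately show "finite \<K>" "finite T" "finite (\<Union>\<K>)" "\<And>K. K \<in> \<K> \<Longrightarrow> finite K"
    using assms(2) finite_subset[of _ X] finite_subset[of \<K> "Pow X"] by auto
qed

lemma even_card_odd_family:
  assumes "odd_family E ends X T \<K>" "finite X"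
  shows "even (card (\<Union>\<K>) + card \<K>)"
proof -
  have fin: "finite \<K>" "\<And>K. K \<in> \<K> \<Longrightarrow> finite K" using odd_family_finite[OF assms] by auto
  have "card (\<Union>\<K>) = (\<Sum>K\<in>\<K>. card K)"
    using assms(1) fin by (intro card_Union_disjoint) (auto simp: odd_family_def)
  moreover have "even ((\<Sum>K\<in>\<K>. card K) + (\<Sum>K\<in>\<K>. 1))"
    unfolding sum.distrib[symmetric] using assms(1) by (intro dvd_sum) (auto simp: odd_family_def)
  ultimately show ?thesis by simp
qed

text \<open>Members are odd, so their union has the parity of \<open>card \<K>\<close>. The formula
  decides whether the left-over vertices form an odd set, that is, a possible further
  member.\<close>

lemma card_odd_family_rest:
  assumes "odd_family E ends X T \<K>" "finite X"
  shows "even (card X + card T + card \<K> + card (X - T - \<Union>\<K>))"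
proof -
  have sub: "T \<subseteq> X" "\<Union>\<K> \<subseteq> X - T" using assms(1) by (auto simp: odd_family_def)
  have "card (X - T - \<Union>\<K>) + card (\<Union>\<K>) + card T = card X"
    using sub assms(2) odd_family_finite[OF assms]
    by (metis add.commute card_Diff_subset card_mono finite_Diff le_add_diff_inverse)
  then show ?thesis using even_card_odd_family[OF assms] by presburger
qed

text \<open>No edge inside \<open>X\<close> joins a left-over vertex to a member, because an edge
  that meets a member stays in that member and \<open>T\<close>.\<close>

lemma odd_family_rest:
  assumes "odd_family E ends X T \<K>" "odd (card (X - T - \<Union>\<K>))"
  shows "odd_family E ends X T (insert (X - T - \<Union>\<K>) \<K>)" "X - T - \<Union>\<K> \<notin> \<K>"
proof -
  have "X - T - \<Union>\<K> \<noteq> {}" using assms(2) by (metis card.empty even_zero)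
  then show "X - T - \<Union>\<K> \<notin> \<K>" by blast
  have "ends d \<subseteq> (X - T - \<Union>\<K>) \<union> T"
    if d: "d \<in> inner E ends X" "ends d \<inter> (X - T - \<Union>\<K>) \<noteq> {}" for d
  proof -
    have "ends d \<inter> K = {}" if "K \<in> \<K>" for K
      using that d assms(1) unfolding odd_family_def by blast
    then show ?thesis using d(1) unfolding inner_def by blast
  qed
  moreover have "\<forall>K\<in>\<K>. disjnt (X - T - \<Union>\<K>) K \<and> disjnt K (X - T - \<Union>\<K>)"
    by (auto simp: disjnt_def)
  ultimately show "odd_family E ends X T (insert (X - T - \<Union>\<K>) \<K>)"
    using assms unfolding odd_family_def pairwise_insert by (simp add: Diff_subset)
qed

text \<open>Induction on \<open>X\<close> via a tight family, one with
  \<open>card \<K> = card T\<close>, in which \<open>T\<close> is as large as possible. Maximality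
  shows that the members cover \<open>X - T\<close> and that each member minus any one vertex has a
  perfect matching; Hall's theorem then assigns the members bijectively to adjacent vertices of
  \<open>T\<close>.\<close>

theorem tutte:
  assumes "finite X" and two: "\<And>d. d \<in> E \<Longrightarrow> card (ends d) = 1 \<or> card (ends d) = 2"
    and "\<And>T \<K>. odd_family E ends X T \<K> \<Longrightarrow> card \<K> \<le> card T"
  shows "\<exists>M. perfect_matching X (inner E ends X) ends M"
  using assms(1,3)
proof (induction X rule: finite_psubset_induct)
  case (psubset X)
  note finX = psubset.hyps(1) and cond = psubset.prems
  let ?tight = "\<lambda>(T, \<K>). odd_family E ends X T \<K> \<and> card \<K> = card T"
  have "odd_family E ends X {} {}" by (simp add: odd_family_def)
  then have "?tight ({}, {})" by simp
  moreover have "\<forall>p. ?tight p \<longrightarrow> card (fst p) < Suc (card X)"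
    using finX by (auto simp: odd_family_def less_Suc_eq_le intro: card_mono)
  ultimately obtain p where p: "?tight p" "\<forall>q. ?tight q \<longrightarrow> card (fst q) \<le> card (fst p)"
    using ex_has_greatest_nat[of ?tight "({}, {})" "\<lambda>p. card (fst p)"] by blast
  obtain T \<K> where pTK: "p = (T, \<K>)" by (cases p)
  have fam: "odd_family E ends X T \<K>" and tight: "card \<K> = card T"
    and maxi: "\<And>T' \<K>'. odd_family E ends X T' \<K>' \<Longrightarrow> card \<K>' = card T' \<Longrightarrow> card T' \<le> card T"
    using p unfolding pTK by auto
  note fin = odd_family_finite[OF fam finX]
  have TX: "T \<subseteq> X" and disj: "pairwise disjnt \<K>" and KX: "\<And>K. K \<in> \<K> \<Longrightarrow> K \<subseteq> X - T"
    and oddK: "\<And>K. K \<in> \<K> \<Longrightarrow> odd (card K)"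
    and closed: "\<And>K d. K \<in> \<K> \<Longrightarrow> d \<in> inner E ends X \<Longrightarrow> ends d \<inter> K \<noteq> {} \<Longrightarrow> ends d \<subseteq> K \<union> T"
    using fam by (auto simp: odd_family_def)
  have "even (card X)"
  proof (rule ccontr)
    assume "odd (card X)"
    then have "odd_family E ends X {} {X}" by (auto simp: odd_family_def inner_def)
    from cond[OF this] show False by simp
  qed
  \<comment> \<open>Tightness and even \<open>card X\<close> make the rest \<open>R\<close> even.
    Moving a vertex \<open>v\<close> of \<open>R\<close> into \<open>T\<close> and adding the odd
    set \<open>R - {v}\<close> as a member would give a tight family with a larger
    \<open>T\<close>.\<close>
  have cover: "X - T - \<Union>\<K> = {}"
  proof (rule ccontr)
    define R where "R = X - T - \<Union>\<K>"
    assume "X - T - \<Union>\<K> \<noteq> {}"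
    then obtain v where v: "v \<in> R" by (auto simp: R_def)
    have finR: "finite R" using finX by (simp add: R_def)
    have "even (card R)"
      using card_odd_family_rest[OF fam finX] tight \<open>even (card X)\<close> unfolding R_def by presburger
    then have oddR: "odd (card (R - {v}))" using v finR card_gt_0_iff[of R] by (auto simp: card_Diff_singleton)
    have R: "X - insert v T - \<Union>\<K> = R - {v}" by (auto simp: R_def)
    have "odd_family E ends X (insert v T) \<K>"
      using fam v unfolding odd_family_def R_def by blast
    from odd_family_rest[OF this, unfolded R, OF oddR]
    have "odd_family E ends X (insert v T) (insert (R - {v}) \<K>)" "R - {v} \<notin> \<K>" by auto
    moreover have "v \<notin> T" using v by (auto simp: R_def)
    ultimately have "card (insert v T) \<le> card T"
      using tight fin by (intro maxi) auto
    then show False using \<open>v \<notin> T\<close> fin by simp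
  qed
  \<comment> \<open>A family in \<open>K - {x}\<close> that violates the condition is grafted onto
    \<open>\<K>\<close> in place of \<open>K\<close>, with \<open>x\<close> and \<open>T'\<close>
    added to \<open>T\<close>; the result would be tight with a larger \<open>T\<close>.\<close>
  have pm_minus: "\<exists>M. perfect_matching (K - {x}) (inner E ends (K - {x})) ends M"
    if K: "K \<in> \<K>" and x: "x \<in> K" for K x
  proof (rule psubset.IH)
    show "K - {x} \<subset> X" using KX[OF K] x by blast
    fix T' \<K>' assume fam': "odd_family E ends (K - {x}) T' \<K>'"
    show "card \<K>' \<le> card T'"
    proof (rule ccontr)
      assume less: "\<not> card \<K>' \<le> card T'"
      have finK: "finite (K - {x})" using fin K by simp
      have evenK: "even (card (K - {x}))" using oddK[OF K] x fin(4)[OF K] by (simp add: card_Diff_singleton)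
      \<comment> \<open>Since \<open>K - {x}\<close> is even, an excess of exactly one leaves an odd
        rest, which becomes a further member. So the excess may be taken to be at least two: one
        makes up for the lost member \<open>K\<close>, the other for \<open>x\<close>.\<close>
      have "\<exists>\<L>. odd_family E ends (K - {x}) T' \<L> \<and> card T' + 2 \<le> card \<L>"
      proof (cases "card \<K>' = card T' + 1")
        case True
        then have "odd (card (K - {x} - T' - \<Union>\<K>'))"
          using card_odd_family_rest[OF fam' finK] evenK by presburger
        from odd_family_rest[OF fam' this] True odd_family_finite[OF fam' finK] show ?thesis
          by (intro exI[of _ "insert (K - {x} - T' - \<Union>\<K>') \<K>'"]) simp
      qed (use less fam' in auto)
      then obtain \<L> where L: "odd_family E ends (K - {x}) T' \<L>" "card T' + 2 \<le> card \<L>" by blast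
      note finL = odd_family_finite[OF L(1) finK]
      have LK: "\<And>L. L \<in> \<L> \<Longrightarrow> L \<subseteq> K - {x} - T'" "T' \<subseteq> K - {x}" and Lodd: "\<And>L. L \<in> \<L> \<Longrightarrow> odd (card L)"
        using L(1) by (auto simp: odd_family_def)
      let ?T = "insert x (T \<union> T')" and ?F = "(\<K> - {K}) \<union> \<L>"
      have Fodd: "odd_family E ends X ?T ?F"
        unfolding odd_family_def
      proof (intro conjI ballI impI)
        show "?T \<subseteq> X" using TX KX[OF K] LK(2) x by blast
        have "disjnt A B" if "A \<in> \<K> - {K}" "B \<in> \<L>" for A B
        proof -
          have "disjnt A K" using that K disj by (auto simp: pairwise_def)
          then show ?thesis using LK(1)[OF that(2)] by (auto simp: disjnt_def)
        qed
        moreover have "pairwise disjnt \<L>" using L(1) by (simp add: odd_family_def)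
        ultimately show "pairwise disjnt ?F"
          using disj unfolding pairwise_def by (metis Diff_iff Un_iff disjnt_sym)
      next
        fix A assume A: "A \<in> ?F"
        show "odd (card A)" using A oddK Lodd by auto
        show "A \<subseteq> X - ?T"
        proof (cases "A \<in> \<L>")
          case True
          then show ?thesis using LK KX[OF K] by blast
        next
          case False
          then have "A \<in> \<K>" "A \<inter> K = {}" using A K disj by (auto simp: pairwise_def disjnt_def)
          then show ?thesis using KX[of A] x LK(2) by blast
        qed
        fix d assume d: "d \<in> inner E ends X" "ends d \<inter> A \<noteq> {}"
        show "ends d \<subseteq> A \<union> ?T"
        proof (cases "A \<in> \<L>")
          case True
          then have "ends d \<subseteq> K \<union> T" using closed[OF K d(1)] LK(1) d(2) by blast
          show ?thesis
          proof (cases "ends d \<subseteq> K - {x}")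
            case in_K: True
            then have "d \<in> inner E ends (K - {x})" using d(1) by (simp add: inner_def)
            then show ?thesis using L(1) True d(2) unfolding odd_family_def by blast
          next
            case False
            then obtain y where y: "y \<in> ends d" "y \<in> insert x T" using \<open>ends d \<subseteq> K \<union> T\<close> by blast
            obtain z where z: "z \<in> ends d" "z \<in> A" using d(2) by blast
            have "z \<noteq> y" using y z LK(1)[OF True] KX[OF K] by blast
            have "ends d = {y, z}"
              using two[of d] d(1) y z \<open>z \<noteq> y\<close> by (intro two_ends) (auto simp: inner_def)
            then show ?thesis using y(2) z(2) by auto
          qed
        next
          case False
          then show ?thesis using closed[OF _ d] A by blast
        qed
      qed
      have dj: "(\<K> - {K}) \<inter> \<L> = {}"
      proof -
        have "A \<inter> K = {}" "A \<noteq> {}" if "A \<in> \<K> - {K}" for A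
          using that K disj oddK[of A] by (auto simp: pairwise_def disjnt_def)
        moreover have "A \<subseteq> K" if "A \<in> \<L>" for A using LK(1)[OF that] by blast
        ultimately show ?thesis by (metis disjoint_iff inf.absorb1)
      qed
      have "card ?F = card \<K> - 1 + card \<L>"
        using dj fin(1) finL(1) K by (subst card_Un_disjoint) (auto simp: card_Diff_singleton)
      moreover have "card \<K> > 0" using K fin(1) by (auto simp: card_gt_0_iff)
      ultimately have ge: "card T + card T' + 1 \<le> card ?F" using L(2) tight by linarith
      have "card ?T = card T + card T' + 1"
      proof -
        have "x \<notin> T \<union> T'" "T \<inter> T' = {}" using x KX[OF K] LK(2) by blast+
        then show ?thesis using fin(2) finL(2) by (simp add: card_Un_disjoint)
      qed
      moreover have "card ?F \<le> card ?T" using cond[OF Fodd] .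
      ultimately have "card ?F = card ?T" using ge by linarith
      from maxi[OF Fodd this] \<open>card ?T = _\<close> show False by simp
    qed
  qed
  \<comment> \<open>The neighbours of \<open>K\<close> in \<open>T\<close>. Hall's condition for a
    subfamily \<open>\<A>\<close> is the hypothesis for \<open>\<A>\<close> with only its own
    neighbours in place of \<open>T\<close>.\<close>
  define N where "N K = {t \<in> T. \<exists>d\<in>E. \<exists>c\<in>K. ends d = {c, t}}" for K
  have "\<exists>f. inj_on f \<K> \<and> (\<forall>K\<in>\<K>. f K \<in> N K)"
  proof (rule hall_marriage)
    show "finite (N K)" for K using fin(2) by (simp add: N_def)
    fix \<A> assume A: "\<A> \<subseteq> \<K>"
    have "odd_family E ends X (\<Union>(N ` \<A>)) \<A>"
      unfolding odd_family_def
    proof (intro conjI ballI impI)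
      show "\<Union>(N ` \<A>) \<subseteq> X" using TX by (auto simp: N_def)
      show "pairwise disjnt \<A>" using disj A by (rule pairwise_subset)
      fix K assume K: "K \<in> \<A>"
      show "odd (card K)" using oddK K A by blast
      have "\<Union>(N ` \<A>) \<subseteq> T" by (auto simp: N_def)
      then show "K \<subseteq> X - \<Union>(N ` \<A>)" using KX[of K] K A by blast
      fix d assume d: "d \<in> inner E ends X" "ends d \<inter> K \<noteq> {}"
      then obtain c where c: "c \<in> ends d" "c \<in> K" by blast
      have dKT: "ends d \<subseteq> K \<union> T" using closed[OF _ d] K A by blast
      show "ends d \<subseteq> K \<union> \<Union>(N ` \<A>)"
      proof
        fix z assume z: "z \<in> ends d"
        show "z \<in> K \<union> \<Union>(N ` \<A>)"
        proof (cases "z \<in> K")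
          case False
          then have "z \<in> T" "z \<noteq> c" using z dKT c by auto
          have "ends d = {c, z}"
            using two[of d] d(1) c z \<open>z \<noteq> c\<close> by (intro two_ends) (auto simp: inner_def)
          then have "z \<in> N K" using \<open>z \<in> T\<close> c d(1) by (auto simp: N_def inner_def)
          then show ?thesis using K by blast
        qed simp
      qed
    qed
    from cond[OF this] show "card \<A> \<le> card (\<Union>(N ` \<A>))" .
  qed (rule fin)
  then obtain f where f: "inj_on f \<K>" "\<And>K. K \<in> \<K> \<Longrightarrow> f K \<in> N K" by blast
  have fT: "f ` \<K> = T"
    using f fin tight by (intro card_subset_eq) (auto simp: N_def card_image)
  \<comment> \<open>The pieces \<open>insert (f K) K\<close> partition \<open>X\<close>. In each, an
    edge from \<open>f K\<close> to some \<open>c\<close> in \<open>K\<close> is completed by a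
    perfect matching of \<open>K - {c}\<close>.\<close>
  have "\<forall>K\<in>\<K>. \<exists>M. perfect_matching (insert (f K) K) (inner E ends (insert (f K) K)) ends M"
  proof
    fix K assume K: "K \<in> \<K>"
    obtain d c where d: "d \<in> E" "c \<in> K" "ends d = {c, f K}" using f(2)[OF K] by (auto simp: N_def)
    have "f K \<in> T" using f(2)[OF K] by (simp add: N_def)
    then have "f K \<notin> K" using KX[OF K] by blast
    then have "card (ends d) = 2" using d by (metis card_2_iff)
    then have e: "perfect_matching (ends d) (inner E ends (ends d)) ends {d}"
      by (rule perfect_matching_edge[OF d(1)])
    obtain M where "perfect_matching (K - {c}) (inner E ends (K - {c})) ends M"
      using pm_minus[OF K d(2)] by blast
    from perfect_matching_Un[OF e this]
    have "perfect_matching (ends d \<union> (K - {c})) (inner E ends (ends d \<union> (K - {c}))) ends ({d} \<union> M)"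
      using d \<open>f K \<notin> K\<close> by auto
    moreover have "ends d \<union> (K - {c}) = insert (f K) K" using d by auto
    ultimately show "\<exists>M. perfect_matching (insert (f K) K) (inner E ends (insert (f K) K)) ends M" by metis
  qed
  then obtain M where M: "\<And>K. K \<in> \<K> \<Longrightarrow>
      perfect_matching (insert (f K) K) (inner E ends (insert (f K) K)) ends (M K)"
    by metis
  have "perfect_matching (\<Union>K\<in>\<K>. insert (f K) K) (inner E ends (\<Union>K\<in>\<K>. insert (f K) K)) ends (\<Union>K\<in>\<K>. M K)"
  proof (rule perfect_matching_UN[OF M])
    fix K L assume KL: "K \<in> \<K>" "L \<in> \<K>" "K \<noteq> L"
    have "f K \<noteq> f L" using f(1) KL by (auto simp: inj_on_def)
    moreover have "K \<inter> L = {}" using disj KL by (auto simp: pairwise_def disjnt_def)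
    moreover have "f K \<in> T" "f L \<in> T" using fT KL by auto
    ultimately show "insert (f K) K \<inter> insert (f L) L = {}" using KX[OF KL(1)] KX[OF KL(2)] by blast
  qed
  moreover have "(\<Union>K\<in>\<K>. insert (f K) K) = X" using fT cover TX KX by blast
  ultimately show ?case by auto
qed

text \<open>The contrapositive of Tutte's theorem with a normalised barrier: left-over vertices are
  absorbed into the family, and evenness of \<open>card X\<close> raises the excess from one to
  two.\<close>

corollary tutte_barrier:
  assumes "finite X" "even (card X)" "\<And>d. d \<in> E \<Longrightarrow> card (ends d) = 1 \<or> card (ends d) = 2"
    and "\<nexists>M. perfect_matching X (inner E ends X) ends M"
  obtains T \<K> where "odd_family E ends X T \<K>" "T \<union> \<Union>\<K> = X" "card T + 2 \<le> card \<K>"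
proof -
  obtain T \<K> where fam: "odd_family E ends X T \<K>" and less: "card T < card \<K>"
  proof (rule ccontr)
    assume "\<not> thesis"
    then have "\<And>T \<K>. odd_family E ends X T \<K> \<Longrightarrow> card \<K> \<le> card T" using that by force
    with tutte[of X E ends] assms show False by blast
  qed
  have "\<exists>\<L>. odd_family E ends X T \<L> \<and> T \<union> \<Union>\<L> = X \<and> card T < card \<L>"
  proof (cases "odd (card (X - T - \<Union>\<K>))")
    case True
    have "T \<union> \<Union>(insert (X - T - \<Union>\<K>) \<K>) = X" using fam by (auto simp: odd_family_def)
    then show ?thesis
      using odd_family_rest[OF fam True] less odd_family_finite(1)[OF fam assms(1)]
      by (intro exI[of _ "insert (X - T - \<Union>\<K>) \<K>"]) simp
  next
    case False
    \<comment> \<open>An even rest has no edges to the members, so it can be united with any one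
      member \<open>K\<close> without changing the parity of that member or the size of the
      family.\<close>
    define R where "R = X - T - \<Union>\<K>"
    note fin = odd_family_finite[OF fam assms(1)]
    obtain K where K: "K \<in> \<K>" using less by fastforce
    have clR: "ends d \<subseteq> R \<union> T" if d: "d \<in> inner E ends X" "ends d \<inter> R \<noteq> {}" for d
    proof -
      have "ends d \<inter> K = {}" if "K \<in> \<K>" for K
        using that d fam unfolding odd_family_def R_def by blast
      then show ?thesis using d(1) unfolding inner_def R_def by blast
    qed
    have RK: "R \<inter> L = {}" if "L \<in> \<K>" for L using that by (auto simp: R_def)
    have "card (K \<union> R) = card K + card R"
      using K fin assms(1) RK[OF K] by (intro card_Un_disjoint) (auto simp: R_def)
    then have odd: "odd (card (K \<union> R))" using False fam K by (auto simp: odd_family_def R_def)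
    let ?L = "insert (K \<union> R) (\<K> - {K})"
    have new: "K \<union> R \<notin> \<K> - {K}"
    proof
      assume *: "K \<union> R \<in> \<K> - {K}"
      have "K \<noteq> {}" using fam K by (auto simp: odd_family_def)
      moreover have "disjnt K (K \<union> R)" using * fam K unfolding odd_family_def pairwise_def by blast
      ultimately show False by (auto simp: disjnt_def)
    qed
    have "odd_family E ends X T ?L"
      unfolding odd_family_def
    proof (intro conjI ballI impI)
      show "T \<subseteq> X" using fam by (simp add: odd_family_def)
      have "disjnt (K \<union> R) L" if "L \<in> \<K> - {K}" for L
      proof -
        have "disjnt K L" using that K fam by (auto simp: odd_family_def pairwise_def)
        then show ?thesis using RK that by (auto simp: disjnt_def)
      qed
      then show "pairwise disjnt ?L"
        using fam unfolding odd_family_def pairwise_insert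
        by (meson Diff_subset disjnt_sym pairwise_subset)
      fix A assume A: "A \<in> ?L"
      show "A \<subseteq> X - T" "odd (card A)" using A fam K odd by (auto simp: odd_family_def R_def)
      show "ends d \<subseteq> A \<union> T" if "d \<in> inner E ends X" "ends d \<inter> A \<noteq> {}" for d
      proof -
        have "ends d \<subseteq> L \<union> T" if "L \<in> \<K>" "ends d \<inter> L \<noteq> {}" for L
          using fam that \<open>d \<in> _\<close> unfolding odd_family_def by blast
        then show ?thesis using A K clR that by blast
      qed
    qed
    moreover have "T \<union> \<Union>?L = X" using fam K by (auto simp: odd_family_def R_def)
    moreover have "card ?L = card \<K>" using new fin card_Suc_Diff1[OF fin(1) K] by (simp del: card_Diff_insert)
    ultimately show ?thesis using less by (intro exI[of _ ?L]) simp
  qed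
  then obtain \<L> where L: "odd_family E ends X T \<L>" "T \<union> \<Union>\<L> = X" "card T < card \<L>" by blast
  have "X - T - \<Union>\<L> = {}" using L(2) by blast
  then have "even (card T + card \<L>)"
    using card_odd_family_rest[OF L(1) assms(1)] assms(2) by (metis add_0_right add.assoc card.empty even_add)
  then have "card T + 2 \<le> card \<L>" using L(3) by presburger
  then show thesis using L that by blast
qed

section \<open>Cuts and circuits\<close>

definition boundary :: "'e set \<Rightarrow> ('e \<Rightarrow> 'v set) \<Rightarrow> 'v set \<Rightarrow> 'e set" where
  "boundary E ends X = {d \<in> E. ends d \<inter> X \<noteq> {} \<and> \<not> ends d \<subseteq> X}"

text \<open>The incidence matrix with integer entries, so that degrees and sums of signed weights
  fall under one double count.\<close>

definition incidence :: "('e \<Rightarrow> 'v set) \<Rightarrow> 'e \<Rightarrow> 'v \<Rightarrow> int" where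
  "incidence ends d v = (if v \<notin> ends d then 0 else if ends d = {v} then 2 else 1)"

lemma degree_eq_sum_incidence:
  assumes "finite F"
  shows "int (degree F ends v) = (\<Sum>d\<in>F. incidence ends d v)"
proof -
  have "int (degree F ends v) = (\<Sum>d\<in>{d\<in>F. v \<in> ends d}. incidence ends d v)"
    unfolding degree_def of_nat_sum by (intro sum.cong) (auto simp: incidence_def)
  also have "\<dots> = (\<Sum>d\<in>F. incidence ends d v)"
    using assms by (intro sum.mono_neutral_left) (auto simp: incidence_def)
  finally show ?thesis .
qed

lemma ends_pair:
  assumes "card A = 1 \<or> card A = 2"
  obtains a b where "A = {a, b}"
  using assms by (metis card_1_singletonE card_2_iff insert_absorb2)

lemma sum_incidence:
  assumes "finite X" "card (ends d) = 1 \<or> card (ends d) = 2"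
  shows "(\<Sum>v\<in>X. incidence ends d v) =
    (if ends d \<subseteq> X then 2 else if ends d \<inter> X \<noteq> {} then 1 else 0)"
proof -
  obtain a b where ab: "ends d = {a, b}" using assms(2) by (rule ends_pair)
  have "incidence ends d v = (if v = a then 1 else 0) + (if v = b then 1 else 0)" for v
    by (auto simp: incidence_def ab)
  then have "(\<Sum>v\<in>X. incidence ends d v) = (if a \<in> X then 1 else 0) + (if b \<in> X then 1 else 0)"
    using assms(1) by (simp add: sum.distrib)
  then show ?thesis by (auto simp: ab)
qed

text \<open>Double counting: an edge inside \<open>X\<close> contributes twice, a boundary edge
  once. The constant weight 1 yields edge counts; the weights of the three matchings yield weight
  sums.\<close>

lemma weighted_handshake:
  fixes \<phi> :: "'e \<Rightarrow> int"
  assumes "finite X" "finite F" "\<And>d. d \<in> F \<Longrightarrow> card (ends d) = 1 \<or> card (ends d) = 2"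
  shows "(\<Sum>v\<in>X. \<Sum>d\<in>F. incidence ends d v * \<phi> d) =
    2 * (\<Sum>d\<in>inner F ends X. \<phi> d) + (\<Sum>d\<in>boundary F ends X. \<phi> d)"
proof -
  have "(\<Sum>v\<in>X. \<Sum>d\<in>F. incidence ends d v * \<phi> d) = (\<Sum>d\<in>F. (\<Sum>v\<in>X. incidence ends d v) * \<phi> d)"
    by (subst sum.swap) (simp add: sum_distrib_right)
  also have "\<dots> = (\<Sum>d\<in>F. (if ends d \<subseteq> X then 2 * \<phi> d else 0) +
      (if ends d \<inter> X \<noteq> {} \<and> \<not> ends d \<subseteq> X then \<phi> d else 0))"
    using assms by (intro sum.cong) (auto simp: sum_incidence)
  also have "\<dots> = (\<Sum>d\<in>inner F ends X. 2 * \<phi> d) + (\<Sum>d\<in>boundary F ends X. \<phi> d)"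
    using assms(2) by (simp add: sum.distrib inner_def boundary_def sum.inter_filter)
  finally show ?thesis by (simp add: sum_distrib_left)
qed

text \<open>An inclusion-minimal nonempty set of at least as many edges as vertices is a circuit:
  minimality forces equality and minimum degree 2, hence 2-regularity, and connectedness.\<close>

lemma ex_circuit:
  assumes "finite F" "F \<noteq> {}" "\<And>d. d \<in> F \<Longrightarrow> card (ends d) = 1 \<or> card (ends d) = 2"
    and "card (\<Union>(ends ` F)) \<le> card F"
  shows "\<exists>C\<subseteq>F. circuit ends C"
  using assms
proof (induction F rule: finite_psubset_induct)
  case (psubset F)
  note finF = psubset.hyps and ne = psubset.prems(1) and two = psubset.prems(2)
  show ?case
  proof (cases "\<exists>G. G \<subset> F \<and> G \<noteq> {} \<and> card (\<Union>(ends ` G)) \<le> card G")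
    case True
    then obtain G where "G \<subset> F" "G \<noteq> {}" "card (\<Union>(ends ` G)) \<le> card G" by blast
    then show ?thesis using psubset.IH[of G] two by (meson order.trans psubset_imp_subset subset_iff)
  next
    case False
    then have mini: "card G < card (\<Union>(ends ` G))" if "G \<subset> F" "G \<noteq> {}" for G
      using that by (meson not_le)
    define U where "U = \<Union>(ends ` F)"
    have fin_ends: "finite (ends d)" "ends d \<noteq> {}" if "d \<in> F" for d
      using two[OF that] by (auto intro: card_ge_0_finite)
    have finU: "finite U" using finF fin_ends by (auto simp: U_def)
    \<comment> \<open>Deleting one of several edges leaves a set that by minimality spans more
      vertices than it has edges, so \<open>F\<close> has no more edges than vertices.\<close>
    have cardU: "card U = card F"
    proof (rule antisym)
      show "card U \<le> card F" using psubset.prems(3) by (simp add: U_def)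
      obtain d where d: "d \<in> F" using ne by blast
      show "card F \<le> card U"
      proof (cases "F = {d}")
        case True
        have "U \<noteq> {}" using fin_ends[OF d] d by (auto simp: U_def)
        then show ?thesis using True finU by (simp add: Suc_le_eq card_gt_0_iff)
      next
        case False
        then have "card (F - {d}) < card (\<Union>(ends ` (F - {d})))" using d by (intro mini) auto
        also have "\<dots> \<le> card U" using finU by (intro card_mono) (auto simp: U_def)
        finally show ?thesis using d finF by (simp add: card_Diff_singleton)
      qed
    qed
    \<comment> \<open>A vertex of degree 1 could be removed together with its edge, contradicting
      minimality.\<close>
    have deg: "2 \<le> (\<Sum>d\<in>F. incidence ends d v)" if v: "v \<in> U" for v
    proof -
      obtain d where d: "d \<in> F" "v \<in> ends d" using v by (auto simp: U_def)
      have nonneg: "0 \<le> incidence ends d' v" for d' by (simp add: incidence_def)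
      show ?thesis
      proof (cases "ends d = {v}")
        case True
        then have "2 \<le> incidence ends d v" by (simp add: incidence_def)
        also have "\<dots> \<le> (\<Sum>d\<in>F. incidence ends d v)"
          using d finF nonneg by (intro member_le_sum) auto
        finally show ?thesis .
      next
        case nonloop: False
        show ?thesis
        proof (cases "\<exists>d'\<in>F. d' \<noteq> d \<and> v \<in> ends d'")
          case True
          then obtain d' where d': "d' \<in> F" "d' \<noteq> d" "v \<in> ends d'" by blast
          have "2 \<le> (\<Sum>d\<in>{d, d'}. incidence ends d v)"
            using d d' by (auto simp: incidence_def)
          also have "\<dots> \<le> (\<Sum>d\<in>F. incidence ends d v)"
            using d d' finF nonneg by (intro sum_mono2) auto
          finally show ?thesis .
        next
          case only: False
          have "F \<noteq> {d}"
          proof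
            assume "F = {d}"
            then have "card (ends d) = 1" using cardU by (simp add: U_def)
            then show False using nonloop d by (auto simp: card_1_singleton_iff)
          qed
          then have "card (F - {d}) < card (\<Union>(ends ` (F - {d})))" using d by (intro mini) auto
          also have "\<dots> \<le> card (U - {v})"
            using finU only by (intro card_mono) (auto simp: U_def)
          finally show ?thesis using d finF v finU cardU by (simp add: card_Diff_singleton)
        qed
      qed
    qed
    have "inner F ends U = F" "boundary F ends U = {}"
      by (auto simp: inner_def boundary_def U_def)
    then have "(\<Sum>v\<in>U. (\<Sum>d\<in>F. incidence ends d v) - 2) = 0"
      using weighted_handshake[OF finU finF two, where \<phi> = "\<lambda>_. 1"] cardU by (simp add: sum_subtractf)
    then have deg2: "(\<Sum>d\<in>F. incidence ends d v) = 2" if "v \<in> U" for v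
      using deg finU that by (subst (asm) sum_nonneg_eq_0_iff) auto
    \<comment> \<open>If the edges \<open>G\<close> reachable from \<open>u\<close> were not all of
      \<open>F\<close>, then \<open>G\<close> and \<open>F - G\<close> would span disjoint vertex
      sets, each larger than its edge set, against \<open>cardU\<close>.\<close>
    have "reach F ends u w" if u: "u \<in> U" and w: "w \<in> U" for u w
    proof -
      define A where "A = {w. reach F ends u w}"
      define G where "G = {d \<in> F. ends d \<inter> A \<noteq> {}}"
      have "u \<in> A" by (simp add: A_def reach_def)
      have GA: "ends d \<subseteq> A" if dG: "d \<in> G" for d
      proof -
        obtain x where x: "x \<in> ends d" "x \<in> A" and d: "d \<in> F" using dG by (auto simp: G_def)
        have "y \<in> A" if "y \<in> ends d" for y
        proof (cases "y = x")
          case False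
          then have "ends d = {x, y}" using two_ends[OF two[OF d] x(1) that] by simp
          then show ?thesis using x(2) d
            unfolding A_def reach_def by (auto intro: rtranclp.rtrancl_into_rtrancl)
        qed (use x in simp)
        then show ?thesis by blast
      qed
      have "G \<noteq> {}" using u \<open>u \<in> A\<close> by (auto simp: G_def U_def)
      have "G = F"
      proof (rule ccontr)
        assume "G \<noteq> F"
        then have G: "G \<subset> F" "F - G \<noteq> {}" by (auto simp: G_def)
        have disj: "\<Union>(ends ` G) \<inter> \<Union>(ends ` (F - G)) = {}" using GA by (auto simp: G_def)
        have finG: "finite (\<Union>(ends ` G))" "finite (\<Union>(ends ` (F - G)))"
          using finU G by (auto simp: U_def elim!: finite_subset[rotated])
        have "card F = card G + card (F - G)"
          using finF G by (metis card_Diff_subset card_mono finite_subset le_add_diff_inverse psubset_imp_subset)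
        also have "\<dots> < card (\<Union>(ends ` G)) + card (\<Union>(ends ` (F - G)))"
          using G \<open>G \<noteq> {}\<close> mini[of G] mini[of "F - G"] by (intro add_strict_mono) auto
        also have "\<dots> = card (\<Union>(ends ` G) \<union> \<Union>(ends ` (F - G)))"
          using disj finG by (intro card_Un_disjoint[symmetric])
        also have "\<Union>(ends ` G) \<union> \<Union>(ends ` (F - G)) = U" using G by (auto simp: U_def)
        finally show False using cardU by simp
      qed
      then have "U \<subseteq> A" using GA by (auto simp: U_def)
      then show ?thesis using w by (auto simp: A_def)
    qed
    moreover have "U \<noteq> {}" using ne fin_ends by (auto simp: U_def)
    ultimately have "circuit ends F"
      using deg2 ne finF degree_eq_sum_incidence[OF finF, of ends]
      unfolding circuit_def connected_graph_def U_def[symmetric] by (metis of_nat_eq_iff of_nat_numeral)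
    then show ?thesis by blast
  qed
qed

section \<open>Edge cuts of a cyclically 4-edge-connected cubic graph\<close>

locale cyclic4_cubic =
  fixes V :: "'v set" and E :: "'e set" and ends :: "'e \<Rightarrow> 'v set"
  assumes cubic: "cubic V E ends" and cyclic4: "cyclically_edge_connected 4 V E ends"
begin

abbreviation ins :: "'v set \<Rightarrow> 'e set" where "ins X \<equiv> inner E ends X"
abbreviation cut :: "'v set \<Rightarrow> 'e set" where "cut X \<equiv> boundary E ends X"

lemma finV: "finite V" and finE: "finite E"
  and two: "d \<in> E \<Longrightarrow> card (ends d) = 1 \<or> card (ends d) = 2"
  and ends_V: "d \<in> E \<Longrightarrow> ends d \<subseteq> V"
  using cubic by (auto simp: cubic_def multigraph_def)

lemma ends_ne: "d \<in> E \<Longrightarrow> ends d \<noteq> {}"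
  using two by fastforce

lemma fin_ins: "finite (ins X)" and fin_cut: "finite (cut X)"
  using finE by (auto simp: inner_def boundary_def)

lemma sum_incidence_3: "v \<in> V \<Longrightarrow> (\<Sum>d\<in>E. incidence ends d v) = 3"
  using cubic degree_eq_sum_incidence[OF finE, of ends v] by (simp add: cubic_def)

lemma card_cut:
  assumes "X \<subseteq> V"
  shows "3 * card X = 2 * card (ins X) + card (cut X)"
proof -
  have finX: "finite X" using assms finV finite_subset by blast
  have "(\<Sum>v\<in>X. \<Sum>d\<in>E. incidence ends d v * 1) = (\<Sum>v\<in>X. 3)"
    using assms by (intro sum.cong) (auto simp: sum_incidence_3)
  then have "3 * int (card X) = 2 * int (card (ins X)) + int (card (cut X))"
    using weighted_handshake[OF finX finE two, where \<phi> = "\<lambda>_. 1"] by simp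
  then show ?thesis by linarith
qed

lemma cut_compl: "X \<subseteq> V \<Longrightarrow> cut (V - X) = cut X"
  using ends_V by (fastforce simp: boundary_def)

text \<open>By \<open>card_cut\<close>, the bound on the cut says that \<open>X\<close> spans at
  least as many edges as it has vertices, which is what \<open>ex_circuit\<close> asks for.\<close>

lemma circuit_in:
  assumes "X \<subseteq> V" "X \<noteq> {}" "card (cut X) < card X + 2"
  shows "\<exists>C\<subseteq>ins X. circuit ends C"
proof (rule ex_circuit[OF fin_ins])
  have finX: "finite X" using assms finV finite_subset by blast
  have le: "card X \<le> card (ins X)" using card_cut[OF assms(1)] assms(3) by linarith
  moreover have "card X > 0" using finX assms(2) by (simp add: card_gt_0_iff)
  ultimately show "ins X \<noteq> {}" by auto
  show "card (ends d) = 1 \<or> card (ends d) = 2" if "d \<in> ins X" for d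
    using that two by (simp add: inner_def)
  have "card (\<Union>(ends ` ins X)) \<le> card X"
    using finX by (intro card_mono) (auto simp: inner_def)
  then show "card (\<Union>(ends ` ins X)) \<le> card (ins X)" using le by linarith
qed

text \<open>The cut serves as the removed edge set: without it no walk leaves
  \<open>X\<close>.\<close>

lemma no_separated_circuits:
  assumes "X \<subseteq> V" "card (cut X) < 4" "C \<subseteq> ins X" "circuit ends C" "D \<subseteq> ins (V - X)" "circuit ends D"
  shows False
proof -
  have inv: "w \<in> X" if "reach (E - cut X) ends u w" "u \<in> X" for u w
    using that unfolding reach_def
    by (induction rule: rtranclp_induct) (auto simp: boundary_def)
  have "cut X \<subseteq> E" by (auto simp: boundary_def)
  moreover have "C \<subseteq> E - cut X" "D \<subseteq> E - cut X"
    using assms(3,5) ends_ne by (fastforce simp: inner_def boundary_def)+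
  moreover have "\<forall>u\<in>\<Union>(ends ` C). \<forall>w\<in>\<Union>(ends ` D). \<not> reach (E - cut X) ends u w"
    using inv assms(3,5) unfolding inner_def by blast
  ultimately show False
    using cyclic4 assms(2,4,6) unfolding cyclically_edge_connected_def by blast
qed

text \<open>By \<open>circuit_in\<close> both sides contain circuits unless one of them, say
  \<open>Y\<close>, satisfies \<open>card Y + 2 \<le> card (cut X)\<close>. With at most three edges
  in the cut, \<open>Y\<close> is then a single vertex and the cut has exactly three.\<close>

lemma small_cut:
  assumes "X \<subseteq> V" "X \<noteq> {}" "X \<noteq> V" "card (cut X) \<le> 3"
  shows "card (cut X) = 3" "card X = 1 \<or> card (V - X) = 1"
proof -
  have ne: "V - X \<noteq> {}" using assms by blast
  have pos: "card X > 0" "card (V - X) > 0"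
    using assms ne finV by (auto simp: card_gt_0_iff intro: finite_subset)
  have or: "card X + 2 \<le> card (cut X) \<or> card (V - X) + 2 \<le> card (cut X)"
  proof (rule ccontr)
    assume *: "\<not> ?thesis"
    obtain C where C: "C \<subseteq> ins X" "circuit ends C" using circuit_in[of X] * assms by auto
    obtain D where D: "D \<subseteq> ins (V - X)" "circuit ends D"
      using circuit_in[of "V - X"] * assms ne by (auto simp: cut_compl)
    show False using no_separated_circuits[OF assms(1) _ C D] assms(4) by simp
  qed
  then show "card (cut X) = 3" "card X = 1 \<or> card (V - X) = 1"
    using pos assms(4) by linarith+
qed

end

section \<open>Barriers for pairs of uncovered edges\<close>

locale three_matchings = cyclic4_cubic V E ends
  for V :: "'v set" and E :: "'e set" and ends :: "'e \<Rightarrow> 'v set" +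
  fixes M1 M2 M3 :: "'e set"
  assumes pm: "perfect_matching V E ends M1" "perfect_matching V E ends M2" "perfect_matching V E ends M3"
    and four: "card (E - (M1 \<union> M2 \<union> M3)) = 4"
begin

text \<open>The number of given matchings containing an edge, shifted so that the weights at each
  vertex sum to \<open>0\<close>.\<close>

definition w :: "'e \<Rightarrow> int" where
  "w d = of_bool (d \<in> M1) + of_bool (d \<in> M2) + of_bool (d \<in> M3) - 1"

section \<open>Weights and uncovered edges\<close>

definition uncovered :: "'e set" where
  "uncovered = {d \<in> E. w d = -1}"

lemma uncovered_eq: "uncovered = E - (M1 \<union> M2 \<union> M3)"
  by (auto simp: uncovered_def w_def)

lemma w_ge: "-1 \<le> w d"
  by (simp add: w_def)

lemma w_neg_iff: "w d < 0 \<longleftrightarrow> w d = -1"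
  using w_ge[of d] by linarith

lemma sum_incidence_matching:
  assumes "perfect_matching V E ends M" "v \<in> V"
  shows "(\<Sum>d\<in>E. incidence ends d v * of_bool (d \<in> M)) = 1"
proof -
  have "\<exists>!d. d \<in> M \<and> v \<in> ends d" using assms by (simp add: perfect_matching_def)
  then obtain d where d: "d \<in> M" "v \<in> ends d" and uniq: "\<And>d'. d' \<in> M \<Longrightarrow> v \<in> ends d' \<Longrightarrow> d' = d"
    by auto
  have "d \<in> E" "card (ends d) = 2" using assms d by (auto simp: perfect_matching_def)
  then have "incidence ends d v = 1" using d by (auto simp: incidence_def)
  moreover have "(\<Sum>d\<in>E. incidence ends d v * of_bool (d \<in> M)) = (\<Sum>d\<in>{d}. incidence ends d v * of_bool (d \<in> M))"
    using finE \<open>d \<in> E\<close> uniq by (intro sum.mono_neutral_right) (auto simp: incidence_def)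
  ultimately show ?thesis using d by simp
qed

lemma vertex_sum:
  assumes "v \<in> V"
  shows "(\<Sum>d\<in>E. incidence ends d v * w d) = 0"
proof -
  have "(\<Sum>d\<in>E. incidence ends d v * w d) =
      (\<Sum>d\<in>E. incidence ends d v * of_bool (d \<in> M1)) + (\<Sum>d\<in>E. incidence ends d v * of_bool (d \<in> M2)) +
      (\<Sum>d\<in>E. incidence ends d v * of_bool (d \<in> M3)) - (\<Sum>d\<in>E. incidence ends d v)"
    unfolding sum.distrib[symmetric] sum_subtractf[symmetric]
    by (intro sum.cong) (auto simp: w_def algebra_simps)
  then show ?thesis using sum_incidence_matching pm sum_incidence_3 assms by simp
qed

lemma cut_sum:
  assumes "X \<subseteq> V"
  shows "2 * sum w (ins X) + sum w (cut X) = 0"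
proof -
  have "finite X" using assms finV finite_subset by blast
  have "(\<Sum>v\<in>X. \<Sum>d\<in>E. incidence ends d v * w d) = 0"
    using assms by (intro sum.neutral) (auto simp: vertex_sum)
  then show ?thesis using weighted_handshake[OF \<open>finite X\<close> finE two, where \<phi> = w] by simp
qed

lemma ins_V: "ins V = E" and cut_V: "cut V = {}"
  using ends_V by (auto simp: inner_def boundary_def)

lemma total_sum: "sum w E = 0"
  using cut_sum[of V] by (simp add: ins_V cut_V)

lemma card_uncovered: "card uncovered = 4"
  using four by (simp add: uncovered_eq)

lemma even_card_V: "even (card V)"
proof -
  have "even (3 * card V)" using card_cut[of V] by (simp add: cut_V)
  then show ?thesis by simp
qed

text \<open>The total weight is 0, so the edges outside \<open>A\<close> weigh -4. Only four edges
  are negative, each of weight -1; hence all four lie outside \<open>A\<close>, and no positive edge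
  does.\<close>

lemma weight_4_cut:
  assumes "A \<subseteq> E" "sum w A = 4"
  shows "d \<in> E \<Longrightarrow> 0 < w d \<Longrightarrow> d \<in> A" "d \<in> A \<Longrightarrow> w d \<noteq> -1"
proof -
  \<comment> \<open>The positive part of \<open>w\<close>: uncovered edges count 0, all others keep
    their weight.\<close>
  define f where "f d = w d + of_bool (w d = -1)" for d
  have f: "0 \<le> f d" for d using w_ge[of d] by (auto simp: f_def)
  have unc: "(\<Sum>d\<in>B. of_bool (w d = -1)) = int (card (uncovered \<inter> B))" if "B \<subseteq> E" for B
  proof -
    have "uncovered \<inter> B = {d \<in> B. w d = -1}" using that by (auto simp: uncovered_def)
    then show ?thesis using that finE by (simp add: sum.inter_filter[symmetric] of_bool_def finite_subset)
  qed
  have finA: "finite A" using assms(1) finE finite_subset by blast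
  have fin: "finite (E - A)" "finite uncovered" using finE by (auto simp: uncovered_def)
  have "sum w (E - A) = - 4" using sum_diff[OF finE assms(1), of w] total_sum assms(2) by simp
  then have sumf: "sum f (E - A) = int (card (uncovered \<inter> (E - A))) - 4"
    using unc[of "E - A"] by (simp add: f_def sum.distrib)
  have le: "card (uncovered \<inter> (E - A)) \<le> card uncovered" using fin by (intro card_mono) auto
  moreover have "0 \<le> sum f (E - A)" using f by (intro sum_nonneg) auto
  ultimately have eq: "card (uncovered \<inter> (E - A)) = card uncovered" and "sum f (E - A) = 0"
    using card_uncovered sumf by linarith+
  then have zero: "f d = 0" if "d \<in> E - A" for d
    using that fin(1) f by (subst (asm) sum_nonneg_eq_0_iff) auto
  show "d \<in> A" if "d \<in> E" "0 < w d" for d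
    using zero[of d] that by (auto simp: f_def)
  have "uncovered \<inter> (E - A) = uncovered" using eq fin by (intro card_subset_eq) auto
  then show "w d \<noteq> -1" if "d \<in> A" for d
    using that assms(1) by (auto simp: uncovered_def)
qed

text \<open>A barrier of the graph without the four ends, enlarged by these ends, gives
  \<open>S\<close>. Counting degrees over \<open>S\<close> leaves an excess of
  \<open>6 - 2 * card (ins S)\<close> over three edges per member of the family, so at most one edge
  besides \<open>p\<close> and \<open>q\<close> lies inside \<open>S\<close>. The weights settle
  both cases.\<close>

lemma barrier:
  assumes pq: "p \<in> uncovered" "q \<in> uncovered" "card (ends p) = 2" "card (ends q) = 2" "ends p \<inter> ends q = {}"
    and none: "\<nexists>M. perfect_matching V E ends M \<and> p \<in> M \<and> q \<in> M"
  obtains (triple) S h where "ends p \<union> ends q \<subseteq> S" "ins S = {p, q, h}" "w h = 2"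
  | (pair) S K where "ends p \<union> ends q \<subseteq> S" "ins S = {p, q}" "K \<inter> S = {}"
      "\<And>d. d \<in> cut K \<Longrightarrow> ends d \<subseteq> K \<union> S" "\<And>d. d \<in> E \<Longrightarrow> 0 < w d \<Longrightarrow> d \<in> cut K"
      "\<And>d. d \<in> cut K \<Longrightarrow> w d \<noteq> -1"
proof -
  have E: "p \<in> E" "q \<in> E" and wpq: "w p = -1" "w q = -1" using pq by (auto simp: uncovered_def)
  have "p \<noteq> q" using pq by auto
  define Q where "Q = ends p \<union> ends q"
  have QV: "Q \<subseteq> V" using ends_V E by (auto simp: Q_def)
  have "card Q = 4" using pq unfolding Q_def by (subst card_Un_disjoint) (auto intro: card_ge_0_finite)
  have finQ: "finite Q" using QV finV finite_subset by blast
  have pmQ: "perfect_matching Q (ins Q) ends ({p} \<union> {q})"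
    unfolding Q_def by (intro perfect_matching_Un perfect_matching_edge E pq)
  have evenX: "even (card (V - Q))"
    using even_card_V QV finQ finV \<open>card Q = 4\<close> by (simp add: card_Diff_subset card_mono)
  have nopm: "\<nexists>M. perfect_matching (V - Q) (ins (V - Q)) ends M"
  proof
    assume "\<exists>M. perfect_matching (V - Q) (ins (V - Q)) ends M"
    then obtain M where "perfect_matching (V - Q) (ins (V - Q)) ends M" by blast
    from perfect_matching_Un[OF pmQ this]
    have "perfect_matching V E ends ({p} \<union> {q} \<union> M)" using QV by (simp add: Un_absorb1 ins_V)
    then show False using none by blast
  qed
  obtain T \<K> where fam: "odd_family E ends (V - Q) T \<K>" and cover: "T \<union> \<Union>\<K> = V - Q"
    and card: "card T + 2 \<le> card \<K>"
    by (rule tutte_barrier[OF finite_Diff[OF finV] evenX two nopm])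
  note fin = odd_family_finite[OF fam finite_Diff[OF finV]]
  define S where "S = Q \<union> T"
  have TV: "T \<subseteq> V - Q" using cover by blast
  have SV: "S \<subseteq> V" and QS: "Q \<subseteq> S" using TV QV by (auto simp: S_def)
  have finS: "finite S" using SV finV finite_subset by blast
  have cardS: "card S = card T + 4"
    unfolding S_def using TV finQ fin \<open>card Q = 4\<close> by (subst card_Un_disjoint) auto
  have disj: "K \<inter> L = {}" if "K \<in> \<K>" "L \<in> \<K>" "K \<noteq> L" for K L
    using fam that by (auto simp: odd_family_def pairwise_def disjnt_def)
  have KV: "K \<subseteq> V" and KS: "K \<inter> S = {}" and oddK: "odd (card K)" if "K \<in> \<K>" for K
    using fam that by (auto simp: odd_family_def S_def)
  have VS: "V - S = \<Union>\<K>" using cover KS TV by (auto simp: S_def)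
  have closed: "ends d \<subseteq> K \<union> S" if K: "K \<in> \<K>" and d: "d \<in> E" "ends d \<inter> K \<noteq> {}" for K d
  proof (cases "ends d \<inter> Q = {}")
    case True
    then have "d \<in> ins (V - Q)" using d ends_V by (auto simp: inner_def)
    then have "ends d \<subseteq> K \<union> T" using fam K d(2) unfolding odd_family_def by blast
    then show ?thesis by (auto simp: S_def)
  next
    case False
    then obtain y z where yz: "y \<in> ends d" "y \<in> Q" "z \<in> ends d" "z \<in> K" using d(2) by blast
    then have "ends d = {y, z}" using KS[OF K] QS by (intro two_ends two d) auto
    then show ?thesis using yz QS by auto
  qed
  have cutK: "ends d \<subseteq> K \<union> S" "ends d \<inter> S \<noteq> {}" "ends d \<inter> K \<noteq> {}" "d \<in> E"
    if "K \<in> \<K>" "d \<in> cut K" for K d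
    using closed[OF that(1), of d] that(2) unfolding boundary_def by blast+
  have cutS: "cut S = (\<Union>K\<in>\<K>. cut K)"
  proof (intro equalityI subsetI)
    fix d assume d: "d \<in> cut S"
    then obtain z where z: "z \<in> ends d" "z \<notin> S" by (auto simp: boundary_def)
    then have "z \<in> \<Union>\<K>" using VS ends_V d by (auto simp: boundary_def)
    then obtain K where K: "K \<in> \<K>" "z \<in> K" by blast
    then have "d \<in> cut K" using d z KS[OF K(1)] by (auto simp: boundary_def)
    then show "d \<in> (\<Union>K\<in>\<K>. cut K)" using K by blast
  next
    fix d assume "d \<in> (\<Union>K\<in>\<K>. cut K)"
    then obtain K where K: "K \<in> \<K>" "d \<in> cut K" by blast
    from cutK[OF K] KS[OF K(1)] show "d \<in> cut S" by (auto simp: boundary_def)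
  qed
  have cut_disj: "cut K \<inter> cut L = {}" if "K \<in> \<K>" "L \<in> \<K>" "K \<noteq> L" for K L
  proof -
    have "\<not> (d \<in> cut K \<and> d \<in> cut L)" for d
      using cutK(1)[OF that(1), of d] cutK(3)[OF that(2), of d] disj[OF that] KS[OF that(2)] by blast
    then show ?thesis by blast
  qed
  have odd_cut: "odd (card (cut K))" if "K \<in> \<K>" for K
  proof -
    have "odd (3 * card K)" using oddK[OF that] by simp
    then show ?thesis unfolding card_cut[OF KV[OF that]] by simp
  qed
  \<comment> \<open>At least four vertices lie outside \<open>K\<close>, so a cut of three edges
    makes \<open>K\<close> a single vertex, and the edges at a vertex have total weight 0.\<close>
  have K_small: "3 \<le> card (cut K)" "card (cut K) = 3 \<Longrightarrow> sum w (cut K) = 0" if K: "K \<in> \<K>" for K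
  proof -
    have "card S \<le> card (V - K)" using SV KS[OF K] finV by (intro card_mono) auto
    then have big: "4 \<le> card (V - K)" using cardS by linarith
    have "K \<noteq> {}" "K \<noteq> V" using oddK[OF K] big by auto
    note small = small_cut[OF KV[OF K] this]
    show "3 \<le> card (cut K)" using small by linarith
    assume 3: "card (cut K) = 3"
    then have "card K = 1" using small big by simp
    then have "card (ins K) = 0" using card_cut[OF KV[OF K]] 3 by linarith
    then have "ins K = {}" using fin_ins by simp
    then show "sum w (cut K) = 0" using cut_sum[OF KV[OF K]] by simp
  qed
  \<comment> \<open>The excess over the minimum cut size. Cut sizes are odd because
    \<open>3 * card K\<close> is, so a nonzero excess is at least 2.\<close>
  define g where "g K = int (card (cut K)) - 3" for K
  have g: "0 \<le> g K" "g K = 0 \<Longrightarrow> sum w (cut K) = 0" "g K \<noteq> 0 \<Longrightarrow> 2 \<le> g K" if "K \<in> \<K>" for K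
  proof -
    have five: "5 \<le> c" if "odd c" "3 \<le> c" "c \<noteq> 3" for c :: nat
      using that by presburger
    show "0 \<le> g K" "g K = 0 \<Longrightarrow> sum w (cut K) = 0" "g K \<noteq> 0 \<Longrightarrow> 2 \<le> g K"
      using K_small[OF that] five[OF odd_cut[OF that]] unfolding g_def by linarith+
  qed
  have "card (cut S) = (\<Sum>K\<in>\<K>. card (cut K))"
    unfolding cutS using fin fin_cut cut_disj by (intro card_UN_disjoint) auto
  then have cS: "int (card (cut S)) = sum g \<K> + 3 * int (card \<K>)"
    by (simp add: g_def sum_subtractf)
  have wS: "sum w (cut S) = (\<Sum>K\<in>\<K>. sum w (cut K))"
    unfolding cutS using fin fin_cut cut_disj by (intro sum.UNION_disjoint) auto
  have pqS: "{p, q} \<subseteq> ins S" using E QS by (auto simp: inner_def Q_def)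
  have two_le: "2 \<le> card (ins S)" using card_mono[OF fin_ins pqS] \<open>p \<noteq> q\<close> by simp
  have gsum: "0 \<le> sum g \<K>" using g by (intro sum_nonneg) auto
  have count: "3 * int (card S) = 2 * int (card (ins S)) + sum g \<K> + 3 * int (card \<K>)"
    using card_cut[OF SV] cS by linarith
  \<comment> \<open>\<open>\<le>\<close> comes from the barrier, \<open>\<ge>\<close> from
    \<open>count\<close>, because \<open>p\<close> and \<open>q\<close> already give two edges
    inside \<open>S\<close>.\<close>
  have "card S = card \<K> + 2" using count gsum two_le cardS card by linarith
  then have count': "sum g \<K> = 6 - 2 * int (card (ins S))" using count by linarith
  then have "card (ins S) = 2 \<or> card (ins S) = 3" using gsum two_le by linarith
  then show thesis
  proof
    assume c3: "card (ins S) = 3"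
    \<comment> \<open>All cuts have three edges and hence weight 0, so the edges inside
      \<open>S\<close> sum to 0 and the third one balances \<open>p\<close> and
      \<open>q\<close>.\<close>
    then have "sum g \<K> = 0" using count' by simp
    then have "sum w (cut S) = 0"
      unfolding wS using g fin by (subst (asm) sum_nonneg_eq_0_iff) auto
    then have "sum w (ins S) = 0" using cut_sum[OF SV] by simp
    have "card (ins S - {p, q}) = 1"
      using c3 pqS \<open>p \<noteq> q\<close> by (simp add: card_Diff_subset)
    then obtain h where h: "ins S - {p, q} = {h}" by (rule card_1_singletonE)
    then have insS: "ins S = {p, q, h}" "h \<noteq> p" "h \<noteq> q" using pqS by auto
    then have "w p + w q + w h = 0" using \<open>sum w (ins S) = 0\<close> \<open>p \<noteq> q\<close> by simp
    then have "w h = 2" using wpq by simp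
    then show thesis using triple[of S h] QS insS by (simp add: Q_def)
  next
    assume c2: "card (ins S) = 2"
    then have insS: "ins S = {p, q}" using pqS \<open>p \<noteq> q\<close> fin_ins card_subset_eq[of "ins S" "{p, q}"] by simp
    \<comment> \<open>The excess 2 sits on a single member \<open>K\<close>, so \<open>cut K\<close>
      weighs as much as \<open>cut S\<close>, namely 4, which balances twice the weight -2 inside
      \<open>S\<close>.\<close>
    have g2: "sum g \<K> = 2" using count' c2 by simp
    then obtain K where K: "K \<in> \<K>" "g K \<noteq> 0" using sum.neutral[of \<K> g] by fastforce
    have "sum g (\<K> - {K}) = 2 - g K" using g2 K fin by (simp add: sum_diff1)
    moreover have "0 \<le> sum g (\<K> - {K})" using g by (intro sum_nonneg) auto
    ultimately have "sum g (\<K> - {K}) = 0" using g(3)[OF K] by linarith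
    then have "\<forall>L\<in>\<K> - {K}. g L = 0" using g fin by (subst (asm) sum_nonneg_eq_0_iff) auto
    then have "(\<Sum>L\<in>\<K> - {K}. sum w (cut L)) = 0" using g by (intro sum.neutral) auto
    then have "sum w (cut S) = sum w (cut K)" unfolding wS using K fin by (simp add: sum.remove)
    moreover have "sum w (ins S) = -2" using insS \<open>p \<noteq> q\<close> wpq by simp
    ultimately have "sum w (cut K) = 4" using cut_sum[OF SV] by simp
    note w4 = weight_4_cut[OF _ this]
    have "cut K \<subseteq> E" by (auto simp: boundary_def)
    then show thesis using pair[of S K] QS insS KS[OF K(1)] cutK(1)[OF K(1)] w4 by (simp add: Q_def)
  qed
qed

section \<open>Pairing the uncovered edges\<close>

text \<open>A loop takes two of the three incidences at its vertex and leaves a cut of at most one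
  edge; a further vertex exists since \<open>card V\<close> is even.\<close>

lemma no_loop:
  assumes "d \<in> E"
  shows "card (ends d) = 2"
proof (rule ccontr)
  assume "card (ends d) \<noteq> 2"
  then have "card (ends d) = 1" using two[OF assms] by simp
  then obtain v where v: "ends d = {v}" by (rule card_1_singletonE)
  have vV: "{v} \<subseteq> V" using ends_V[OF assms] v by simp
  have "{v} \<noteq> V" using even_card_V by auto
  have "d \<in> ins {v}" using assms v by (simp add: inner_def)
  then have "card (ins {v}) > 0" using fin_ins card_gt_0_iff by blast
  then have "card (cut {v}) < 3" using card_cut[OF vV] by simp
  with small_cut(1)[OF vV] \<open>{v} \<noteq> V\<close> show False by simp
qed

text \<open>At most two edges leave the common ends of two parallel edges, so these ends would be
  all of \<open>V\<close>, with three edges at most: fewer than the four uncovered ones.\<close>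

lemma no_parallel:
  assumes "d \<in> E" "d' \<in> E" "ends d = ends d'"
  shows "d = d'"
proof (rule ccontr)
  assume "d \<noteq> d'"
  have "{d, d'} \<subseteq> ins (ends d)" using assms by (simp add: inner_def)
  then have "2 \<le> card (ins (ends d))" using card_mono[OF fin_ins, of "{d, d'}" "ends d"] \<open>d \<noteq> d'\<close> by simp
  moreover note cc = card_cut[OF ends_V[OF assms(1)], unfolded no_loop[OF assms(1)]]
  ultimately have "card (cut (ends d)) < 3" by linarith
  then have "ends d = V"
    using small_cut(1)[OF ends_V ends_ne, of d] assms(1) by force
  then have "card E \<le> 3" using cc by (simp add: ins_V)
  moreover have "card uncovered \<le> card E" using finE by (intro card_mono) (auto simp: uncovered_def)
  ultimately show False using card_uncovered by simp
qed

text \<open>At most three edges leave a triangle, so by \<open>small_cut\<close> a single vertex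
  lies outside it.\<close>

lemma triangle:
  assumes "d1 \<in> E" "d2 \<in> E" "d3 \<in> E" "ends d1 = {a, b}" "ends d2 = {b, c}" "ends d3 = {c, a}"
  shows "card V = 4"
proof -
  have ne: "a \<noteq> b" "b \<noteq> c" "c \<noteq> a" using no_loop assms by fastforce+
  let ?X = "{a, b, c}"
  have XV: "?X \<subseteq> V" using ends_V[of d1] ends_V[of d2] assms by simp
  have "card ?X = 3" using ne by simp
  have "?X \<noteq> V" using even_card_V \<open>card ?X = 3\<close> by auto
  have "{d1, d2, d3} \<subseteq> ins ?X" using assms by (auto simp: inner_def)
  moreover have "card {d1, d2, d3} = 3"
  proof -
    have "d1 \<noteq> d2" "d2 \<noteq> d3" "d1 \<noteq> d3" using assms ne by (auto simp: doubleton_eq_iff)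
    then show ?thesis by simp
  qed
  ultimately have "3 \<le> card (ins ?X)" using card_mono[OF fin_ins] by metis
  then have "card (cut ?X) \<le> 3" using card_cut[OF XV] \<open>card ?X = 3\<close> by linarith
  then have "card (V - ?X) = 1" using small_cut(2)[OF XV _ \<open>?X \<noteq> V\<close>] \<open>card ?X = 3\<close> by simp
  moreover have "card (V - ?X) = card V - card ?X" by (rule card_Diff_subset[OF _ XV]) simp
  moreover have "card ?X \<le> card V" by (rule card_mono[OF finV XV])
  ultimately show ?thesis using \<open>card ?X = 3\<close> by linarith
qed

section \<open>Weights around a vertex\<close>

lemma star_at:
  assumes "d \<in> E" "v \<in> ends d"
  obtains y z where "{f \<in> E. v \<in> ends f} = {d, y, z}" "d \<noteq> y" "d \<noteq> z" "y \<noteq> z" "w d + w y + w z = 0"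
proof -
  have v: "{v} \<subseteq> V" using assms ends_V by blast
  have "ins {v} = {}"
  proof (rule ccontr)
    assume "ins {v} \<noteq> {}"
    then obtain f where f: "f \<in> E" "ends f \<subseteq> {v}" by (auto simp: inner_def)
    then have "card (ends f) \<le> card {v}" by (intro card_mono) auto
    then show False using no_loop[OF f(1)] by simp
  qed
  then have c: "card (cut {v}) = 3" "sum w (cut {v}) = 0"
    using card_cut[OF v] cut_sum[OF v] by auto
  have star: "cut {v} = {f \<in> E. v \<in> ends f}"
    using \<open>ins {v} = {}\<close> by (auto simp: boundary_def inner_def)
  have d: "d \<in> cut {v}" using assms star by simp
  then have "card (cut {v} - {d}) = 2" using c fin_cut by (simp add: card_Diff_singleton)
  then obtain y z where yz: "cut {v} - {d} = {y, z}" "y \<noteq> z" by (auto simp: card_2_iff)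
  then have "cut {v} = {d, y, z}" "d \<noteq> y" "d \<noteq> z" using d by auto
  then show thesis using that[of y z] c(2) yz(2) star by simp
qed

lemma ends_other:
  assumes "d \<in> E" "v \<in> ends d"
  obtains a where "ends d = {v, a}" "v \<noteq> a"
  using no_loop[OF assms(1)] assms(2) by (auto simp: card_2_iff doubleton_eq_iff)

text \<open>Weights are at least -1, so by \<open>star_at\<close> the three weights at a vertex are,
  up to order, (0, 0, 0), (1, 0, -1) or (2, -1, -1). This and the next statements are read off that
  list.\<close>

lemma positive_at_uncovered:
  assumes "d \<in> uncovered" "v \<in> ends d"
  shows "\<exists>x\<in>E. v \<in> ends x \<and> 0 < w x"
proof -
  have d: "d \<in> E" "w d = -1" using assms by (auto simp: uncovered_def)
  obtain y z where "{f \<in> E. v \<in> ends f} = {d, y, z}" "d \<noteq> y" "d \<noteq> z" "y \<noteq> z" "w d + w y + w z = 0"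
    using star_at[OF d(1) assms(2)] .
  then have "0 < w y \<or> 0 < w z" "y \<in> {f \<in> E. v \<in> ends f}" "z \<in> {f \<in> E. v \<in> ends f}" using d by auto
  then show ?thesis by auto
qed

lemma uncovered_at_positive:
  assumes "x \<in> E" "v \<in> ends x" "0 < w x"
  shows "\<exists>d\<in>uncovered. v \<in> ends d"
proof -
  obtain y z where "{f \<in> E. v \<in> ends f} = {x, y, z}" "x \<noteq> y" "x \<noteq> z" "y \<noteq> z" "w x + w y + w z = 0"
    using star_at[OF assms(1,2)] .
  then have "w y < 0 \<or> w z < 0" "y \<in> {f \<in> E. v \<in> ends f}" "z \<in> {f \<in> E. v \<in> ends f}" using assms by auto
  then show ?thesis by (auto simp: uncovered_def w_neg_iff)
qed

lemma positive_unique: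
  assumes "x \<in> E" "y \<in> E" "v \<in> ends x" "v \<in> ends y" "0 < w x" "0 < w y"
  shows "x = y"
proof (rule ccontr)
  assume "x \<noteq> y"
  obtain s t where st: "{f \<in> E. v \<in> ends f} = {x, s, t}" "x \<noteq> s" "x \<noteq> t" "s \<noteq> t" "w x + w s + w t = 0"
    using star_at[OF assms(1,3)] .
  have "y \<in> {f \<in> E. v \<in> ends f}" using assms by simp
  then have "y = s \<or> y = t" using st(1) \<open>x \<noteq> y\<close> by auto
  then show False using st(5) assms(5,6) w_ge[of s] w_ge[of t] by auto
qed

lemma two_uncovered_at:
  assumes "d \<in> uncovered" "d' \<in> uncovered" "d \<noteq> d'" "v \<in> ends d" "v \<in> ends d'"
  shows "\<exists>x\<in>E. v \<in> ends x \<and> w x = 2"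
proof -
  have d: "d \<in> E" "d' \<in> E" "w d = -1" "w d' = -1" using assms by (auto simp: uncovered_def)
  obtain y z where yz: "{f \<in> E. v \<in> ends f} = {d, y, z}" "d \<noteq> y" "d \<noteq> z" "y \<noteq> z" "w d + w y + w z = 0"
    using star_at[OF d(1) assms(4)] .
  have "d' \<in> {f \<in> E. v \<in> ends f}" using d assms by simp
  then have "d' = y \<or> d' = z" using yz(1) assms(3) by auto
  moreover have "y \<in> {f \<in> E. v \<in> ends f}" "z \<in> {f \<in> E. v \<in> ends f}" using yz(1) by auto
  ultimately show ?thesis using yz(5) d by auto
qed

lemma star_at_triple:
  assumes "g \<in> E" "v \<in> ends g" "w g = 2"
  obtains d e a b where "{f \<in> E. v \<in> ends f} = {g, d, e}" "d \<in> uncovered" "e \<in> uncovered" "d \<noteq> e"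
    "ends d = {v, a}" "ends e = {v, b}" "v \<noteq> a" "v \<noteq> b" "a \<noteq> b" "a \<notin> ends g" "b \<notin> ends g"
proof -
  obtain d e where st: "{f \<in> E. v \<in> ends f} = {g, d, e}" "g \<noteq> d" "g \<noteq> e" "d \<noteq> e" "w g + w d + w e = 0"
    using star_at[OF assms(1,2)] .
  have "d \<in> {f \<in> E. v \<in> ends f}" "e \<in> {f \<in> E. v \<in> ends f}" using st by auto
  then have de: "d \<in> E" "v \<in> ends d" "e \<in> E" "v \<in> ends e" by auto
  obtain a where a: "ends d = {v, a}" "v \<noteq> a" using ends_other[OF de(1,2)] .
  obtain b where b: "ends e = {v, b}" "v \<noteq> b" using ends_other[OF de(3,4)] .
  obtain c where c: "ends g = {v, c}" "v \<noteq> c" using ends_other[OF assms(1,2)] .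
  have "a \<noteq> b" "a \<noteq> c" "b \<noteq> c"
    using no_parallel[of d e] no_parallel[of d g] no_parallel[of e g] a b c de assms(1) st by auto
  moreover have "w d = -1" "w e = -1" using st(5) assms(3) w_ge[of d] w_ge[of e] by auto
  ultimately show thesis using that[of d e a b] st a b c de by (auto simp: uncovered_def)
qed

section \<open>Perfect matchings through two uncovered edges\<close>

lemma matching_through_linked_pair:
  assumes "p \<in> uncovered" "q \<in> uncovered" "ends p \<inter> ends q = {}"
    and "x \<in> E" "y \<in> E" "x \<noteq> y" "0 < w x" "0 < w y" "ends x \<union> ends y \<subseteq> ends p \<union> ends q"
  shows "\<exists>M. perfect_matching V E ends M \<and> p \<in> M \<and> q \<in> M"
proof (rule ccontr)
  assume none: "\<nexists>M. perfect_matching V E ends M \<and> p \<in> M \<and> q \<in> M"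
  have pq: "card (ends p) = 2" "card (ends q) = 2" "w p = -1" "w q = -1"
    using assms(1,2) no_loop by (auto simp: uncovered_def)
  \<comment> \<open>Both outcomes of \<open>barrier\<close> allow at most one edge inside
    \<open>S\<close> besides \<open>p\<close> and \<open>q\<close>, but the two positive edges
    \<open>x\<close> and \<open>y\<close> lie there.\<close>
  have sub: "x \<in> ins S" "y \<in> ins S" if "ends p \<union> ends q \<subseteq> S" for S
    using that assms by (auto simp: inner_def)
  from assms(1,2) pq(1,2) assms(3) none show False
  proof (cases rule: barrier)
    case (triple S h)
    then show False using sub[OF triple(1)] assms(6-8) pq by auto
  next
    case (pair S K)
    then show False using sub[OF pair(1)] assms(7) pq by auto
  qed
qed

text \<open>Without triply covered edges, a positive edge \<open>x\<close> links two uncovered edges (or the two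
  ends of a single one), and a barrier for an uncovered pair would separate the pair from the
  remaining uncovered edges by a cut through \<open>x\<close>.\<close>

lemma matching_through_pair:
  assumes le: "\<And>d. d \<in> E \<Longrightarrow> w d \<noteq> 2"
    and pq: "p \<in> uncovered" "q \<in> uncovered" "p \<noteq> q"
    and x: "x \<in> E" "ends x = {u, u'}" "0 < w x"
    and d: "d \<in> uncovered" "d' \<in> uncovered" "u \<in> ends d" "u' \<in> ends d'"
    and same: "d \<in> {p, q} \<longleftrightarrow> d' \<in> {p, q}"
  shows "\<exists>M. perfect_matching V E ends M \<and> p \<in> M \<and> q \<in> M"
proof (rule ccontr)
  assume none: "\<nexists>M. perfect_matching V E ends M \<and> p \<in> M \<and> q \<in> M"
  have pq2: "card (ends p) = 2" "card (ends q) = 2" using pq no_loop by (auto simp: uncovered_def)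
  \<comment> \<open>Two uncovered edges at a vertex force an edge of weight 2 there, which
    \<open>le\<close> excludes.\<close>
  have disj: "ends p \<inter> ends q = {}" using two_uncovered_at[OF pq] le by blast
  from pq(1,2) pq2 disj none show False
  proof (cases rule: barrier)
    case (triple S h)
    then have "h \<in> ins S" by simp
    then show False using le triple by (auto simp: inner_def)
  next
    case (pair S K)
    \<comment> \<open>Each end of \<open>f\<close> lies on a positive edge, which belongs to
      \<open>cut K\<close> and so has its ends in \<open>K \<union> S\<close>; \<open>f\<close>
      itself does not cross, having weight -1.\<close>
    have sides: "ends f \<subseteq> S \<or> ends f \<subseteq> K" if f: "f \<in> uncovered" for f
    proof -
      have "t \<in> S \<union> K" if t: "t \<in> ends f" for t
      proof -
        obtain y where "y \<in> E" "t \<in> ends y" "0 < w y" using positive_at_uncovered[OF f t] by blast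
        then show ?thesis using pair(4,5)[of y] by blast
      qed
      moreover have "f \<notin> cut K" using pair(6)[of f] f by (auto simp: uncovered_def)
      moreover have "f \<in> E" using f by (simp add: uncovered_def)
      ultimately show ?thesis unfolding boundary_def by blast
    qed
    have in_S: "ends f \<subseteq> S \<longleftrightarrow> f \<in> {p, q}" if "f \<in> uncovered" for f
      using pair(2) that by (auto simp: inner_def uncovered_def)
    \<comment> \<open>Since \<open>x\<close> joins \<open>S\<close> to \<open>K\<close>, exactly one
      of \<open>d\<close> and \<open>d'\<close> lies in \<open>S\<close>, that is, in
      \<open>{p, q}\<close>, contrary to \<open>same\<close>.\<close>
    have "x \<in> cut K" using pair(5) x by simp
    then have "u \<in> S \<and> u' \<in> K \<or> u \<in> K \<and> u' \<in> S"
      using pair(3) pair(4)[of x] x(2) by (auto simp: boundary_def)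
    moreover have "u \<in> S \<longleftrightarrow> d \<in> {p, q}" "u' \<in> S \<longleftrightarrow> d' \<in> {p, q}"
      using sides[OF d(1)] sides[OF d(2)] in_S[OF d(1)] in_S[OF d(2)] d(3,4) pair(3) by blast+
    ultimately show False using same pair(3) by blast
  qed
qed

text \<open>One positive edge \<open>x\<close> serves both pairs: the uncovered edges met by the two
  ends of \<open>x\<close> are put into the same pair, and \<open>matching_through_pair\<close>
  applies to either pair.\<close>

lemma cover_no_triple:
  assumes le: "\<And>d. d \<in> E \<Longrightarrow> w d \<noteq> 2"
  shows "\<exists>M N. perfect_matching V E ends M \<and> perfect_matching V E ends N \<and> uncovered \<subseteq> M \<union> N"
proof -
  have fin: "finite uncovered" using finE by (simp add: uncovered_def)
  have "uncovered \<noteq> {}" using card_uncovered by auto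
  then obtain d0 where "d0 \<in> uncovered" by blast
  moreover then have "ends d0 \<noteq> {}" using ends_ne by (auto simp: uncovered_def)
  ultimately obtain x where x: "x \<in> E" "0 < w x" using positive_at_uncovered by blast
  obtain u u' where ux: "ends x = {u, u'}" using ends_pair[OF two[OF x(1)]] .
  have "u \<in> ends x" "u' \<in> ends x" using ux by auto
  then obtain d d' where d: "d \<in> uncovered" "d' \<in> uncovered" "u \<in> ends d" "u' \<in> ends d'"
    using uncovered_at_positive[OF x(1) _ x(2)] by metis
  \<comment> \<open>If both ends of \<open>x\<close> meet the same uncovered edge \<open>d\<close>,
    any other uncovered edge may be its partner; otherwise the partner is \<open>d'\<close>.\<close>
  have "\<exists>q\<in>uncovered. q \<noteq> d \<and> d' \<in> {d, q}"
  proof (cases "d' = d")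
    case True
    have "card (uncovered - {d}) = 3" using card_uncovered d by (simp add: card_Diff_singleton)
    then have "uncovered - {d} \<noteq> {}" by (metis card.empty zero_neq_numeral)
    then show ?thesis using True by blast
  qed (use d in auto)
  then obtain q where q: "q \<in> uncovered" "q \<noteq> d" "d' \<in> {d, q}" by blast
  have "card (uncovered - {d, q}) = 2"
    using card_uncovered d q by (simp add: card_Diff_subset)
  then obtain r s where rs: "uncovered - {d, q} = {r, s}" "r \<noteq> s" by (auto simp: card_2_iff)
  then have rsU: "r \<in> uncovered" "s \<in> uncovered" "d \<notin> {r, s}" "d' \<notin> {r, s}" using q by auto
  obtain M where M: "perfect_matching V E ends M" "d \<in> M" "q \<in> M"
    using matching_through_pair[OF le d(1) q(1) q(2)[symmetric] x(1) ux x(2) d] q(3) by auto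
  obtain N where N: "perfect_matching V E ends N" "r \<in> N" "s \<in> N"
    using matching_through_pair[OF le rsU(1,2) rs(2) x(1) ux x(2) d] rsU by auto
  have "uncovered \<subseteq> {d, q} \<union> {r, s}" unfolding rs(1)[symmetric] by blast
  also have "\<dots> \<subseteq> M \<union> N" using M(2,3) N(2,3) by simp
  finally have "uncovered \<subseteq> M \<union> N" .
  then show ?thesis using M N by blast
qed

text \<open>The ends of \<open>g\<close> account for all four uncovered edges. Positive edges
  \<open>x\<close> and \<open>y\<close> match the far ends \<open>a1\<close>, \<open>a2\<close> with
  \<open>a3\<close>, \<open>a4\<close>. When the uncovered edges are paired accordingly, each pair
  spans \<open>g\<close> and one of \<open>x\<close>, \<open>y\<close>, so
  \<open>matching_through_linked_pair\<close> applies.\<close>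

lemma cover_triple:
  assumes g: "g \<in> E" "w g = 2"
  shows "\<exists>M N. perfect_matching V E ends M \<and> perfect_matching V E ends N \<and> uncovered \<subseteq> M \<union> N"
proof -
  obtain u v where gv: "ends g = {u, v}" using ends_pair[OF two[OF g(1)]] .
  have "u \<noteq> v" using no_loop[OF g(1)] gv by auto
  obtain e1 e2 a1 a2 where st_u: "{f \<in> E. u \<in> ends f} = {g, e1, e2}" and e12: "e1 \<in> uncovered" "e2 \<in> uncovered" "e1 \<noteq> e2"
    "ends e1 = {u, a1}" "ends e2 = {u, a2}" and a12: "u \<noteq> a1" "u \<noteq> a2" "a1 \<noteq> a2" "a1 \<notin> ends g" "a2 \<notin> ends g"
    by (rule star_at_triple[OF g(1) _ g(2), of u]) (simp_all add: gv)
  obtain e3 e4 a3 a4 where st_v: "{f \<in> E. v \<in> ends f} = {g, e3, e4}" and e34: "e3 \<in> uncovered" "e4 \<in> uncovered" "e3 \<noteq> e4"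
    "ends e3 = {v, a3}" "ends e4 = {v, a4}" and a34: "v \<noteq> a3" "v \<noteq> a4" "a3 \<noteq> a4" "a3 \<notin> ends g" "a4 \<notin> ends g"
    by (rule star_at_triple[OF g(1) _ g(2), of v]) (simp_all add: gv)
  have unc: "uncovered = {e1, e2, e3, e4}"
  proof -
    have "v \<notin> ends e1" "v \<notin> ends e2" using e12 a12 gv \<open>u \<noteq> v\<close> by auto
    then have "e1 \<noteq> e3" "e1 \<noteq> e4" "e2 \<noteq> e3" "e2 \<noteq> e4" using e34 by auto
    then have "card {e1, e2, e3, e4} = card uncovered" using e12 e34 card_uncovered by simp
    then have "{e1, e2, e3, e4} = uncovered"
      using e12 e34 finE by (intro card_subset_eq) (auto simp: uncovered_def)
    then show ?thesis by simp
  qed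
  \<comment> \<open>The positive edge at \<open>a\<close> avoids \<open>u\<close> and
    \<open>v\<close>, where \<open>g\<close> is the only positive edge, and its other end
    \<open>b\<close> meets an uncovered edge; so \<open>b\<close> is another far end.\<close>
  have link: "\<exists>x\<in>E. 0 < w x \<and> (ends x = {a, a3} \<and> a \<noteq> a3 \<or> ends x = {a, a4} \<and> a \<noteq> a4)"
    if e: "{e, e'} = {e1, e2}" "ends e = {u, a}" "ends e' = {u, a'}" and a: "{a, a'} = {a1, a2}" for e e' a a'
  proof -
    have ee: "e \<in> uncovered" "e' \<in> uncovered" using e(1) e12 by auto
    have aa: "a \<notin> ends g" "a' \<notin> ends g" "a \<noteq> a'" using a a12 by (auto simp: doubleton_eq_iff)
    obtain x where x: "x \<in> E" "a \<in> ends x" "0 < w x"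
      using positive_at_uncovered[OF ee(1), of a] e(2) by auto
    obtain b where b: "ends x = {a, b}" "a \<noteq> b" using ends_other[OF x(1,2)] .
    have "x \<noteq> g" using x(2) aa by auto
    have nuv: "b \<noteq> u" "b \<noteq> v"
      using positive_unique[OF x(1) g(1), of u] positive_unique[OF x(1) g(1), of v] x(3) g(2) b gv \<open>x \<noteq> g\<close> by auto
    obtain f where f: "f \<in> uncovered" "b \<in> ends f" using uncovered_at_positive[OF x(1) _ x(3), of b] b by auto
    have "b = a1 \<or> b = a2 \<or> b = a3 \<or> b = a4" using f unc nuv e12 e34 by auto
    then have b': "b = a' \<or> b = a3 \<or> b = a4" using a b(2) by (auto simp: doubleton_eq_iff)
    show ?thesis
    proof (cases "b = a3 \<or> b = a4")
      case False
      \<comment> \<open>A triangle on \<open>u\<close>, \<open>a\<close>, \<open>a'\<close> leaves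
        only \<open>v\<close> as a further vertex, so \<open>a3\<close> and \<open>a4\<close> are
        \<open>a\<close> and \<open>a'\<close> in some order and \<open>b\<close> is one of them
        after all.\<close>
      then have "b = a'" using b' by simp
      have eE: "e \<in> E" "e' \<in> E" using ee by (auto simp: uncovered_def)
      have "card V = 4"
        using triangle[OF eE(1) x(1) eE(2), of u a a'] e(2,3) b(1) \<open>b = a'\<close> by (simp add: insert_commute)
      moreover have sub: "{u, v, a, a'} \<subseteq> V" "a3 \<in> V" "a4 \<in> V"
        using ends_V[OF g(1)] ends_V[OF eE(1)] ends_V[OF eE(2)] ends_V[of e3] ends_V[of e4] e34 e gv
        by (auto simp: uncovered_def)
      moreover have "card {u, v, a, a'} = 4" using aa gv \<open>u \<noteq> v\<close> by (simp add: eq_commute)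
      ultimately have "V = {u, v, a, a'}" using finV card_subset_eq[of V "{u, v, a, a'}"] by simp
      then have "a3 \<in> {a, a'}" "a4 \<in> {a, a'}" using sub a34 gv by auto
      then show ?thesis using False a34 \<open>b = a'\<close> by auto
    qed (use x b in auto)
  qed
  obtain x where x: "x \<in> E" "0 < w x" "ends x = {a1, a3} \<and> a1 \<noteq> a3 \<or> ends x = {a1, a4} \<and> a1 \<noteq> a4"
    using link[of e1 e2 a1 a2] e12 by blast
  obtain y where y: "y \<in> E" "0 < w y" "ends y = {a2, a3} \<and> a2 \<noteq> a3 \<or> ends y = {a2, a4} \<and> a2 \<noteq> a4"
    using link[of e2 e1 a2 a1] e12 by blast
  \<comment> \<open>Stated for either order of \<open>e3\<close> and \<open>e4\<close>:
    \<open>f\<close> is the one whose far end \<open>b\<close> is reached by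
    \<open>x\<close>.\<close>
  have good: ?thesis
    if f: "{f, f'} = {e3, e4}" "ends f = {v, b}" "ends f' = {v, b'}" "{b, b'} = {a3, a4}"
      and xb: "ends x = {a1, b}" "a1 \<noteq> b" for f f' b b'
  proof -
    have ff: "f \<in> uncovered" "f' \<in> uncovered" using f(1) e34 by auto
    have bb: "b \<notin> {u, v}" "b' \<notin> {u, v}" using f(4) a34 gv by (auto simp: doubleton_eq_iff)
    have yb: "ends y = {a2, b} \<and> a2 \<noteq> b \<or> ends y = {a2, b'} \<and> a2 \<noteq> b'"
      using y(3) f(4) by (auto simp: doubleton_eq_iff)
    have "ends y \<noteq> {a2, b}"
    proof
      \<comment> \<open>Only one positive edge meets \<open>b\<close>, so \<open>y\<close> has to
        reach the other far end \<open>b'\<close>.\<close>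
      assume "ends y = {a2, b}"
      then have "x = y" using positive_unique[OF x(1) y(1), of b] xb x(2) y(2) by simp
      then show False using \<open>ends y = {a2, b}\<close> xb a12 by (auto simp: doubleton_eq_iff)
    qed
    then have yb': "ends y = {a2, b'}" "a2 \<noteq> b'" using yb by auto
    have ne: "g \<noteq> x" "g \<noteq> y" using xb yb' a12 gv by auto
    have "\<exists>M. perfect_matching V E ends M \<and> e1 \<in> M \<and> f \<in> M"
      using e12 ff f xb a12 bb gv \<open>u \<noteq> v\<close> ne x g
      by (intro matching_through_linked_pair[of e1 f g x]) auto
    moreover have "\<exists>M. perfect_matching V E ends M \<and> e2 \<in> M \<and> f' \<in> M"
      using e12 ff f yb' a12 bb gv \<open>u \<noteq> v\<close> ne y g
      by (intro matching_through_linked_pair[of e2 f' g y]) auto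
    ultimately obtain M N where "perfect_matching V E ends M" "e1 \<in> M" "f \<in> M"
      "perfect_matching V E ends N" "e2 \<in> N" "f' \<in> N" by blast
    moreover have "uncovered = {e1, e2} \<union> {f, f'}" unfolding unc f(1) by blast
    ultimately show ?thesis by (intro exI[of _ M] exI[of _ N]) simp
  qed
  show ?thesis
    using x(3) good[of e3 e4 a3 a4] good[of e4 e3 a4 a3] e34 by (auto simp: insert_commute)
qed

end

section \<open>Assembling the five matchings\<close>

theorem theorem5p3:
  fixes V :: "'v set" and E :: "'e set" and ends :: "'e \<Rightarrow> 'v set"
  assumes "cubic V E ends"
    and "cyclically_edge_connected 4 V E ends"
    and "colouring_defect V E ends = 4"
  shows "\<exists>\<M>. finite \<M> \<and> card \<M> \<le> 5 \<and> (\<forall>M\<in>\<M>. perfect_matching V E ends M) \<and> \<Union>\<M> = E"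
proof -
  define D where "D = {card (E - (M1 \<union> M2 \<union> M3)) | M1 M2 M3.
      perfect_matching V E ends M1 \<and> perfect_matching V E ends M2 \<and> perfect_matching V E ends M3}"
  have "finite E" using assms(1) by (simp add: cubic_def multigraph_def)
  have "D \<subseteq> card ` Pow E" by (auto simp: D_def)
  then have "finite D" using \<open>finite E\<close> by (auto intro: finite_subset)
  have "(if D = {} then 0 else Min D) = 4"
    using assms(3) unfolding colouring_defect_def D_def Let_def .
  \<comment> \<open>The value 4 differs from the default 0 for empty \<open>D\<close>, so the
    minimum is attained by some triple of perfect matchings.\<close>
  then have "4 \<in> D" using Min_in[OF \<open>finite D\<close>] by (auto split: if_splits)
  then obtain M1 M2 M3 where pm: "perfect_matching V E ends M1" "perfect_matching V E ends M2"
    "perfect_matching V E ends M3" and four: "card (E - (M1 \<union> M2 \<union> M3)) = 4"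
    by (auto simp: D_def)
  interpret three_matchings V E ends M1 M2 M3
    using assms(1,2) pm four by unfold_locales
  obtain M N where MN: "perfect_matching V E ends M" "perfect_matching V E ends N" "uncovered \<subseteq> M \<union> N"
    using cover_triple cover_no_triple by blast
  let ?\<M> = "{M1, M2, M3, M, N}"
  have sub: "M \<subseteq> E" if "perfect_matching V E ends M" for M
    using that by (simp add: perfect_matching_def)
  have "\<Union>?\<M> = E" 
  proof
    show "\<Union>?\<M> \<subseteq> E" using sub[OF pm(1)] sub[OF pm(2)] sub[OF pm(3)] sub[OF MN(1)] sub[OF MN(2)] by simp
    show "E \<subseteq> \<Union>?\<M>" using MN(3) unfolding uncovered_eq by auto
  qed
  moreover have "card ?\<M> \<le> 5" by (simp add: card_insert_if)
  ultimately show ?thesis using pm MN by (intro exI[of _ ?\<M>]) auto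
qed

end
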